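(* Let $\beta\in(0,1)$, $A<0$, $\alpha\in(1,2)$, $\gamma\in(0,1)$ with $\alpha+\gamma>2$, $\tau$ with $\tau+\gamma>1$, $p\ge1$, and let $h:\mathbb{R}\to\mathbb{R}$ be measurable. Let $\mathcal{E}$ be a family of continuous functions $\xi:[0,\infty)\to\mathbb{R}$ contained in a normed linear space $(\mathcal{X},\|\cdot\|_{\mathcal{X}})$. For $\xi\in\mathcal{E}$ and admissible $(f,\theta)$ (see context) consider the equations, for $t\ge0$, $$X(t)=\xi_t+\frac{1}{\Gamma(\beta)}\int_0^t (t-s)^{\beta-1}[A X(s)+h(X(s))]\,ds+\frac{1}{\Gamma(\alpha)}\int_0^t(t-s)^{\alpha-1}f(s)\,d\theta_s,\qquad (1)$$ $$Y(t)=\xi_t+\frac{1}{\Gamma(\beta)}\int_0^t (t-s)^{\beta-1}A Y(s)\,ds+\frac{1}{\Gamma(\alpha)}\int_0^t(t-s)^{\alpha-1}f(s)\,d\theta_s.\qquad (2)$$ (a) Suppose there are $\delta_0>0$ and $C>0$ such that $A+C<0$ and $|h(x)|\le C|x|$ for all $|x|<\delta_0$. If the solution of (2) is asymptotically $(\mathcal{E},p)$-stable, then any continuous solution of (1) is also asymptotically $(\mathcal{E},p)$-stable. (b) Suppose there is $C>0$ such that $A+C<0$ and $|h(x)|\le C|x|$ for all $x\in\mathbb{R}$. If the solution of (2) is globally $\mathcal{E}$-stable in the large, then any continuous solution of (1) is also globally $\mathcal{E}$-stable in the large.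
   Context: $\Gamma$ is the Gamma function. A pair $(f,\theta)$ is admissible if $\theta:[0,\infty)\to\mathbb{R}$ is $\gamma$-Hölder continuous (on each compact interval $[0,T]$) with $\theta_0=0$, and $f\in C^1(\mathbb{R}_+)$ is $\tau$-Hölder continuous (on each compact interval $[0,T]$); $\dot f$ is the derivative of $f$. Integrals $\int \cdot\, d\theta_s$ are Young integrals, i.e. limits of Riemann sums $\sum_i \phi_{t_i}(\theta_{t_{i+1}}-\theta_{t_i})$ as the mesh of the partition tends to $0$. Equation (2) has a unique continuous solution for each $(\xi,f,\theta)$. For either equation, (any) continuous solution is said to be: - $(\mathcal{E},p)$-stable if for every $\varepsilon>0$ there is $\delta>0$ such that for all $\xi\in\mathcal{E}$ and admissible $(f,\theta)$ with $$\|\xi\|_{\mathcal{X}}+\|f\theta\|_{L^1([0,\infty))}+\|f\theta\|_{L^p([0,\infty))}+\|\dot f\theta\|_{L^1([0,\infty))}<\delta,\qquad (3)$$ every continuous solution $X:[0,\infty)\to\mathbb{R}$ satisfies $\sup_{t\ge0}|X(t)|<\varepsilon$; - asymptotically $(\mathcal{E},p)$-stable if it is $(\mathcal{E},p)$-stable and there is $\delta>0$ such that every continuous solution tends to $0$ as $t\to\infty$ for all $(\xi,f,\theta)$ satisfying (3); - globally $\mathcal{E}$-stable in the large (for given admissible $(f,\theta)$) if for every $\xi\in\mathcal{E}$ every continuous solution tends to $0$ as $t\to\infty$. *)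

theory Defs
  imports "HOL-Analysis.Analysis"
begin

text \<open>Functions on \<open>[0,\<infinity>)\<close> are represented by functions \<open>real \<Rightarrow> real\<close>; none of the notions
  below depends on their values at negative arguments.\<close>

definition holder_on_compacts :: "real \<Rightarrow> (real \<Rightarrow> real) \<Rightarrow> bool" where
  "holder_on_compacts \<gamma> g \<longleftrightarrow>
     (\<forall>T\<ge>0. \<exists>K\<ge>0. \<forall>s\<in>{0..T}. \<forall>t\<in>{0..T}. \<bar>g t - g s\<bar> \<le> K * \<bar>t - s\<bar> powr \<gamma>)"

text \<open>The derivative at \<open>0\<close> is the right-hand derivative.\<close>

definition halfline_deriv :: "(real \<Rightarrow> real) \<Rightarrow> real \<Rightarrow> real" where
  "halfline_deriv f t = vector_derivative f (at t within {0..})"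

definition C1_halfline :: "(real \<Rightarrow> real) \<Rightarrow> bool" where
  "C1_halfline f \<longleftrightarrow>
     (\<forall>t\<ge>0. (f has_real_derivative halfline_deriv f t) (at t within {0..})) \<and>
     continuous_on {0..} (halfline_deriv f)"

definition admissible :: "real \<Rightarrow> real \<Rightarrow> (real \<Rightarrow> real) \<Rightarrow> (real \<Rightarrow> real) \<Rightarrow> bool" where
  "admissible \<gamma> \<tau> f \<theta> \<longleftrightarrow>
     holder_on_compacts \<gamma> \<theta> \<and> \<theta> 0 = 0 \<and> C1_halfline f \<and> holder_on_compacts \<tau> f"

definition is_partition :: "real \<Rightarrow> real \<Rightarrow> nat \<Rightarrow> (nat \<Rightarrow> real) \<Rightarrow> bool" where
  "is_partition a b n u \<longleftrightarrow> u 0 = a \<and> u n = b \<and> (\<forall>i<n. u i < u (Suc i))"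

definition has_young_integral ::
  "(real \<Rightarrow> real) \<Rightarrow> (real \<Rightarrow> real) \<Rightarrow> real \<Rightarrow> real \<Rightarrow> real \<Rightarrow> bool" where
  "has_young_integral \<phi> \<theta> a b I \<longleftrightarrow>
     (\<forall>\<epsilon>>0. \<exists>\<eta>>0. \<forall>n u. is_partition a b n u \<and> (\<forall>i<n. u (Suc i) - u i < \<eta>) \<longrightarrow>
        \<bar>(\<Sum>i<n. \<phi> (u i) * (\<theta> (u (Suc i)) - \<theta> (u i))) - I\<bar> < \<epsilon>)"

text \<open>Being a solution includes the existence of both integrals. At \<open>s = t\<close> the kernels
  \<open>(t - s) powr (\<beta> - 1)\<close> and \<open>(t - s) powr (\<alpha> - 1)\<close> take the value \<open>0\<close>, as \<open>0 powr r = 0\<close>;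
  for the singular one this concerns a null set only.\<close>

definition solution_nonlinear ::
  "real \<Rightarrow> real \<Rightarrow> real \<Rightarrow> (real \<Rightarrow> real) \<Rightarrow>
   (real \<Rightarrow> real) \<Rightarrow> (real \<Rightarrow> real) \<Rightarrow> (real \<Rightarrow> real) \<Rightarrow> (real \<Rightarrow> real) \<Rightarrow> bool" where
  "solution_nonlinear \<alpha> \<beta> A h \<xi> f \<theta> X \<longleftrightarrow>
     continuous_on {0..} X \<and>
     (\<forall>t\<ge>0.
        set_integrable lborel {0..t} (\<lambda>s. (t - s) powr (\<beta> - 1) * (A * X s + h (X s))) \<and>
        (\<exists>J. has_young_integral (\<lambda>s. (t - s) powr (\<alpha> - 1) * f s) \<theta> 0 t J \<and>
           X t = \<xi> t
             + 1 / Gamma \<beta> * (LINT s:{0..t}|lborel. (t - s) powr (\<beta> - 1) * (A * X s + h (X s)))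
             + 1 / Gamma \<alpha> * J))"

definition solution_linear ::
  "real \<Rightarrow> real \<Rightarrow> real \<Rightarrow>
   (real \<Rightarrow> real) \<Rightarrow> (real \<Rightarrow> real) \<Rightarrow> (real \<Rightarrow> real) \<Rightarrow> (real \<Rightarrow> real) \<Rightarrow> bool" where
  "solution_linear \<alpha> \<beta> A \<xi> f \<theta> Y \<longleftrightarrow>
     continuous_on {0..} Y \<and>
     (\<forall>t\<ge>0.
        set_integrable lborel {0..t} (\<lambda>s. (t - s) powr (\<beta> - 1) * (A * Y s)) \<and>
        (\<exists>J. has_young_integral (\<lambda>s. (t - s) powr (\<alpha> - 1) * f s) \<theta> 0 t J \<and>
           Y t = \<xi> t
             + 1 / Gamma \<beta> * (LINT s:{0..t}|lborel. (t - s) powr (\<beta> - 1) * (A * Y s))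
             + 1 / Gamma \<alpha> * J))"

definition Lp_norm_halfline :: "real \<Rightarrow> (real \<Rightarrow> real) \<Rightarrow> ennreal" where
  "Lp_norm_halfline p g =
     (let I = (\<integral>\<^sup>+ t\<in>{0..}. ennreal (\<bar>g t\<bar> powr p) \<partial>lborel)
      in if I = top then top else ennreal (enn2real I powr (1 / p)))"

text \<open>The initial data are vectors \<open>\<xi>\<close> of a normed space \<open>'x\<close>, and \<open>ev \<xi>\<close> is the function
  \<open>[0,\<infinity>) \<rightarrow> \<real>\<close> which \<open>\<xi>\<close> is. The argument \<open>Sol\<close> of the stability notions is the solution
  relation of the equation in question, with arguments initial function, \<open>f\<close>, \<open>\<theta>\<close>, solution.\<close>

definition small_data ::
  "real \<Rightarrow> 'x::real_normed_vector \<Rightarrow> (real \<Rightarrow> real) \<Rightarrow> (real \<Rightarrow> real) \<Rightarrow> real \<Rightarrow> bool" where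
  "small_data p \<xi> f \<theta> \<delta> \<longleftrightarrow>
     ennreal (norm \<xi>)
     + Lp_norm_halfline 1 (\<lambda>t. f t * \<theta> t)
     + Lp_norm_halfline p (\<lambda>t. f t * \<theta> t)
     + Lp_norm_halfline 1 (\<lambda>t. halfline_deriv f t * \<theta> t) < ennreal \<delta>"

definition stable ::
  "real \<Rightarrow> real \<Rightarrow> ('x::real_normed_vector \<Rightarrow> real \<Rightarrow> real) \<Rightarrow> 'x set \<Rightarrow> real \<Rightarrow>
   ((real \<Rightarrow> real) \<Rightarrow> (real \<Rightarrow> real) \<Rightarrow> (real \<Rightarrow> real) \<Rightarrow> (real \<Rightarrow> real) \<Rightarrow> bool) \<Rightarrow> bool" where
  "stable \<gamma> \<tau> ev E p Sol \<longleftrightarrow>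
     (\<forall>\<epsilon>>0. \<exists>\<delta>>0. \<forall>\<xi>\<in>E. \<forall>f \<theta>. admissible \<gamma> \<tau> f \<theta> \<and> small_data p \<xi> f \<theta> \<delta> \<longrightarrow>
        (\<forall>X. Sol (ev \<xi>) f \<theta> X \<longrightarrow> (SUP t\<in>{0..}. ennreal \<bar>X t\<bar>) < ennreal \<epsilon>))"

definition asymptotically_stable ::
  "real \<Rightarrow> real \<Rightarrow> ('x::real_normed_vector \<Rightarrow> real \<Rightarrow> real) \<Rightarrow> 'x set \<Rightarrow> real \<Rightarrow>
   ((real \<Rightarrow> real) \<Rightarrow> (real \<Rightarrow> real) \<Rightarrow> (real \<Rightarrow> real) \<Rightarrow> (real \<Rightarrow> real) \<Rightarrow> bool) \<Rightarrow> bool" where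
  "asymptotically_stable \<gamma> \<tau> ev E p Sol \<longleftrightarrow>
     stable \<gamma> \<tau> ev E p Sol \<and>
     (\<exists>\<delta>>0. \<forall>\<xi>\<in>E. \<forall>f \<theta>. admissible \<gamma> \<tau> f \<theta> \<and> small_data p \<xi> f \<theta> \<delta> \<longrightarrow>
        (\<forall>X. Sol (ev \<xi>) f \<theta> X \<longrightarrow> (X \<longlongrightarrow> 0) at_top))"

definition globally_stable_in_the_large ::
  "('x::real_normed_vector \<Rightarrow> real \<Rightarrow> real) \<Rightarrow> 'x set \<Rightarrow> (real \<Rightarrow> real) \<Rightarrow> (real \<Rightarrow> real) \<Rightarrow>
   ((real \<Rightarrow> real) \<Rightarrow> (real \<Rightarrow> real) \<Rightarrow> (real \<Rightarrow> real) \<Rightarrow> (real \<Rightarrow> real) \<Rightarrow> bool) \<Rightarrow> bool" where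
  "globally_stable_in_the_large ev E f \<theta> Sol \<longleftrightarrow>
     (\<forall>\<xi>\<in>E. \<forall>X. Sol (ev \<xi>) f \<theta> X \<longrightarrow> (X \<longlongrightarrow> 0) at_top)"

end

theory Submission
  imports Defs
begin

text \<open>Integration by parts turns the Young integral into
  \<open>\<Gamma>(\<alpha>)\<close> times \<open>I\<^sup>\<alpha>\<^sup>-\<^sup>1(f\<theta>) - I\<^sup>\<alpha>(f'\<theta>)\<close>, with \<open>I\<^sup>b\<close> the Riemann--Liouville integral,
  so the forcing is continuous and (2) is solved by a Neumann series. For a solution \<open>Y\<close> of (2) with
  the same data, \<open>Z = X - Y\<close> satisfies \<open>Z = I\<^sup>\<beta>(h(X) - cZ)\<close> with \<open>c = -A\<close>. The relaxation function
  \<open>S = 1 - c I\<^sup>\<beta> S\<close> is positive and nonincreasing because the kernel is log-convex, and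
  \<open>c \<integral>\<^sub>0\<^sup>t W = \<integral>\<^sub>0\<^sup>t (1 - S(t - u)) \<kappa>(u) du\<close> whenever \<open>W = I\<^sup>\<beta>(\<kappa> - cW)\<close>; hence \<open>\<kappa> \<ge> 0\<close>
  implies \<open>W \<ge> 0\<close>. This comparison principle bounds \<open>|Z|\<close> by \<open>(C / c) sup |X|\<close> with \<open>C / c < 1\<close>, which
  excludes a first exit of \<open>X\<close> from a small ball and, applied to late times, shows that \<open>limsup |X|\<close>
  contracts to \<open>0\<close>.\<close>

section \<open>Fractional integrals\<close>

text \<open>Taking absolute values in (1) would turn the damping A into growth, and a Gronwall
  estimate would then give no bound uniform in t. The sign of A has to be used, and comparison is
  how a kernel with memory lets one use it. Subtracting Y removes \<xi> and the rough forcing, so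
  only the size of Y enters. Since h is merely measurable, h(X) is a bounded measurable forcing,
  whereas Z is continuous as a difference of solutions; hence the work is done on integral equations
  and Z is never differentiated. Variation of constants would use the resolvent kernel -S', singular
  at 0 for \<beta> < 1. Passing to the primitive of W replaces it by S itself, of which continuity,
  positivity and monotonicity suffice. The factor 1/c arises because constant forcing 1 has the
  solution (1 - S)/c, which stays below 1/c. For decay, forcing before a late time T is weighted by
  S(t - T) - S(t), which tends to 0 because S is monotone and bounded below. Y has to be
  constructed, since stability of (2) speaks only of solutions that are given.\<close>

lemma set_integrable_lborel_reflect:
  fixes f :: "real \<Rightarrow> real"
  shows "set_integrable lborel {a..t} f \<longleftrightarrow> set_integrable lborel {0..t - a} (\<lambda>u. f (t - u))"
proof -
  have "indicator {a..t} (t + - 1 * x) = (indicator {0..t - a} x :: real)" for x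
    by (auto simp: indicator_def)
  then show ?thesis
    using lborel_integrable_real_affine_iff[of "-1" "\<lambda>x. indicator {a..t} x *\<^sub>R f x" t]
    unfolding set_integrable_def by simp
qed

lemma set_integral_lborel_reflect:
  fixes f :: "real \<Rightarrow> real"
  shows "(LINT s:{a..t}|lborel. f s) = (LINT u:{0..t - a}|lborel. f (t - u))"
proof -
  have "indicator {a..t} (t + - 1 * x) = (indicator {0..t - a} x :: real)" for x
    by (auto simp: indicator_def)
  then show ?thesis
    using lborel_integral_real_affine[of "-1" "\<lambda>x. indicator {a..t} x *\<^sub>R f x" t]
    unfolding set_lebesgue_integral_def by simp
qed

lemma set_integral_lborel_shift:
  fixes f :: "real \<Rightarrow> real"
  shows "(LINT u:{a..b}|lborel. f (u + c)) = (LINT s:{a + c..b + c}|lborel. f s)"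
proof -
  have "indicator {a + c..b + c} (c + 1 * x) = (indicator {a..b} x :: real)" for x
    by (auto simp: indicator_def)
  then show ?thesis
    using lborel_integral_real_affine[of 1 "\<lambda>x. indicator {a + c..b + c} x *\<^sub>R f x" c]
    unfolding set_lebesgue_integral_def by (simp add: add.commute)
qed

lemma set_integral_Icc_split:
  fixes f :: "real \<Rightarrow> real"
  assumes "a \<le> r" "r \<le> b" "set_integrable lborel {a..b} f"
  shows "(LINT s:{a..b}|lborel. f s) = (LINT s:{a..r}|lborel. f s) + (LINT s:{r..b}|lborel. f s)"
proof -
  have "(LINT s:{a..r} \<union> {r..b}|lborel. f s) = (LINT s:{a..r}|lborel. f s) + (LINT s:{r..b}|lborel. f s)"
  proof (rule set_integral_Un_AE)
    show "AE x in lborel. \<not> (x \<in> {a..r} \<and> x \<in> {r..b})"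
      using AE_lborel_singleton[of r] by eventually_elim auto
  qed (use assms in \<open>auto intro!: set_integrable_subset[OF assms(3)]\<close>)
  then show ?thesis using assms by (simp add: ivl_disj_un_two_touch)
qed

text \<open>Nonnegativity upgrades gauge integrability to absolute integrability for the completed
  measure; Borel measurability then brings it back to \<open>lborel\<close>.\<close>

lemma powr_set_integrable:
  fixes b t :: real
  assumes "0 < b"
  shows "set_integrable lborel {0..t} (\<lambda>u. u powr (b - 1))"
proof (cases "0 \<le> t")
  case True
  have "(\<lambda>u. u powr (b - 1)) integrable_on {0..t}"
    using has_integral_powr_from_0[of "b - 1" t] assms True by (auto simp: integrable_on_def)
  then have "set_integrable lebesgue {0..t} (\<lambda>u. u powr (b - 1))"
    by (intro nonnegative_absolutely_integrable_1) auto
  moreover have "(\<lambda>x. indicator {0..t} x *\<^sub>R x powr (b - 1)) \<in> borel_measurable lborel"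
    by measurable
  ultimately show ?thesis
    unfolding set_integrable_def using integrable_completion by blast
qed (auto simp: set_integrable_def)

lemma powr_set_integral:
  fixes b t :: real
  assumes "0 < b" "0 \<le> t"
  shows "(LINT u:{0..t}|lborel. u powr (b - 1)) = t powr b / b"
proof -
  have "(LINT u:{0..t}|lborel. u powr (b - 1)) = integral {0..t} (\<lambda>u. u powr (b - 1))"
    using powr_set_integrable[OF assms(1)] by (rule set_borel_integral_eq_integral)
  also have "\<dots> = t powr b / b"
    using has_integral_powr_from_0[of "b - 1" t] assms by (simp add: integral_unique)
  finally show ?thesis .
qed

lemma kernel_set_integrable:
  fixes b t :: real
  assumes "0 < b"
  shows "set_integrable lborel {a..t} (\<lambda>s. (t - s) powr (b - 1))"
  using powr_set_integrable[OF assms, of "t - a"]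
  by (subst set_integrable_lborel_reflect) simp

lemma kernel_set_integral:
  fixes b t :: real
  assumes "0 < b" "a \<le> t"
  shows "(LINT s:{a..t}|lborel. (t - s) powr (b - 1)) = (t - a) powr b / b"
  using powr_set_integral[OF assms(1), of "t - a"] assms
  by (subst set_integral_lborel_reflect) simp

lemma continuous_on_halfline_bounded:
  fixes f :: "real \<Rightarrow> real"
  assumes "continuous_on {0..} f"
  obtains M where "0 \<le> M" "\<And>s. 0 \<le> s \<Longrightarrow> s \<le> T \<Longrightarrow> \<bar>f s\<bar> \<le> M"
proof -
  have "compact (f ` {0..T})"
    by (intro compact_continuous_image continuous_on_subset[OF assms]) auto
  then obtain M where M: "\<forall>x\<in>f ` {0..T}. norm x \<le> M"
    using compact_imp_bounded bounded_iff by metis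
  show ?thesis
    by (rule that[of "max 0 M"]) (use M in \<open>auto simp: image_iff le_max_iff_disj\<close>)
qed

lemma continuous_on_set_borel_measurable:
  fixes f :: "real \<Rightarrow> real"
  assumes "continuous_on {0..} f" "0 \<le> a"
  shows "set_borel_measurable lborel {a..t} f"
  unfolding set_borel_measurable_def
  using borel_measurable_continuous_on_indicator[OF _ continuous_on_subset[OF assms(1), of "{a..t}"]] assms(2)
  by auto

text \<open>Boundedness and measurability are the right generality for \<open>\<phi>\<close>, since
  it will also stand for forcings built from \<open>h\<close> composed with a solution.\<close>

lemma kernel_mult_set_integrable:
  fixes b t B :: real
  assumes "0 < b" and meas: "set_borel_measurable lborel {a..t} \<phi>"
    and bdd: "\<And>s. a \<le> s \<Longrightarrow> s \<le> t \<Longrightarrow> \<bar>\<phi> s\<bar> \<le> B"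
  shows "set_integrable lborel {a..t} (\<lambda>s. (t - s) powr (b - 1) * \<phi> s)"
proof (rule set_integrable_bound[where f = "\<lambda>s. (t - s) powr (b - 1) * B"])
  show "set_integrable lborel {a..t} (\<lambda>s. (t - s) powr (b - 1) * B)"
    using kernel_set_integrable[OF assms(1)] by simp
  have "(\<lambda>s. (t - s) powr (b - 1) * (indicator {a..t} s *\<^sub>R \<phi> s)) \<in> borel_measurable lborel"
    using meas unfolding set_borel_measurable_def by measurable
  then show "set_borel_measurable lborel {a..t} (\<lambda>s. (t - s) powr (b - 1) * \<phi> s)"
    unfolding set_borel_measurable_def by (simp add: ac_simps)
  show "AE s in lborel. s \<in> {a..t} \<longrightarrow>
      norm ((t - s) powr (b - 1) * \<phi> s) \<le> norm ((t - s) powr (b - 1) * B)"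
    using bdd by (intro AE_I2) (force simp: abs_mult intro!: mult_left_mono)
qed

section \<open>The Riemann-Liouville integral: linearity, order, scaling and continuity\<close>

definition frac_integral :: "real \<Rightarrow> (real \<Rightarrow> real) \<Rightarrow> real \<Rightarrow> real" where
  "frac_integral b \<phi> t = 1 / Gamma b * (LINT s:{0..t}|lborel. (t - s) powr (b - 1) * \<phi> s)"

text \<open>Additivity and order of the Bochner integral need integrability of each term, so it is
  tracked separately; a non-integrable term would silently have integral 0.\<close>

definition kernel_integrable :: "real \<Rightarrow> (real \<Rightarrow> real) \<Rightarrow> real \<Rightarrow> bool" where
  "kernel_integrable b \<phi> t \<longleftrightarrow> set_integrable lborel {0..t} (\<lambda>s. (t - s) powr (b - 1) * \<phi> s)"

lemma kernel_integrable_bounded: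
  assumes "0 < b" "set_borel_measurable lborel {0..t} \<phi>"
    and "\<And>s. 0 \<le> s \<Longrightarrow> s \<le> t \<Longrightarrow> \<bar>\<phi> s\<bar> \<le> B"
  shows "kernel_integrable b \<phi> t"
  unfolding kernel_integrable_def using assms by (rule kernel_mult_set_integrable)

lemma kernel_integrable_continuous:
  assumes "0 < b" "continuous_on {0..} \<phi>"
  shows "kernel_integrable b \<phi> t"
proof -
  obtain M where "\<And>s. 0 \<le> s \<Longrightarrow> s \<le> t \<Longrightarrow> \<bar>\<phi> s\<bar> \<le> M"
    using continuous_on_halfline_bounded[OF assms(2)] by blast
  then show ?thesis
    by (intro kernel_integrable_bounded[OF assms(1) continuous_on_set_borel_measurable[OF assms(2)]]) auto
qed

lemma kernel_integrable_diff:
  "kernel_integrable b \<phi> t \<Longrightarrow> kernel_integrable b \<psi> t \<Longrightarrow> kernel_integrable b (\<lambda>s. \<phi> s - \<psi> s) t"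
  unfolding kernel_integrable_def by (simp add: right_diff_distrib set_integral_diff)

lemma kernel_integrable_mult:
  "kernel_integrable b \<phi> t \<Longrightarrow> kernel_integrable b (\<lambda>s. c * \<phi> s) t"
  unfolding kernel_integrable_def by (simp add: mult.left_commute)

lemma kernel_integrable_uminus:
  "kernel_integrable b \<phi> t \<Longrightarrow> kernel_integrable b (\<lambda>s. - \<phi> s) t"
  using kernel_integrable_mult[of b \<phi> t "-1"] by simp

lemma frac_integral_add:
  "kernel_integrable b \<phi> t \<Longrightarrow> kernel_integrable b \<psi> t \<Longrightarrow>
    frac_integral b (\<lambda>s. \<phi> s + \<psi> s) t = frac_integral b \<phi> t + frac_integral b \<psi> t"
  unfolding kernel_integrable_def frac_integral_def by (simp add: distrib_left set_integral_add add_divide_distrib)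

lemma frac_integral_diff:
  "kernel_integrable b \<phi> t \<Longrightarrow> kernel_integrable b \<psi> t \<Longrightarrow>
    frac_integral b (\<lambda>s. \<phi> s - \<psi> s) t = frac_integral b \<phi> t - frac_integral b \<psi> t"
  unfolding kernel_integrable_def frac_integral_def by (simp add: right_diff_distrib set_integral_diff diff_divide_distrib)

lemma frac_integral_mult:
  "frac_integral b (\<lambda>s. c * \<phi> s) t = c * frac_integral b \<phi> t"
  unfolding frac_integral_def by (simp add: mult.left_commute)

lemma frac_integral_uminus:
  "frac_integral b (\<lambda>s. - \<phi> s) t = - frac_integral b \<phi> t"
  using frac_integral_mult[of b "-1" \<phi> t] by simp

lemma frac_integral_mono:
  assumes "0 < b" "kernel_integrable b \<phi> t" "kernel_integrable b \<psi> t"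
    and "\<And>s. 0 \<le> s \<Longrightarrow> s \<le> t \<Longrightarrow> \<phi> s \<le> \<psi> s"
  shows "frac_integral b \<phi> t \<le> frac_integral b \<psi> t"
  using assms Gamma_real_pos[OF assms(1)] unfolding kernel_integrable_def frac_integral_def
  by (intro mult_left_mono set_integral_mono) (auto intro: mult_left_mono)

lemma frac_integral_reflect:
  "frac_integral b \<phi> t = 1 / Gamma b * (LINT u:{0..t}|lborel. u powr (b - 1) * \<phi> (t - u))"
  unfolding frac_integral_def by (subst set_integral_lborel_reflect) simp

text \<open>The substitution s = t x moves the dependence on t out of the domain and the singular
  kernel into a prefactor and the argument of \<open>\<phi>\<close>, a form suited to dominated
  convergence.\<close>

lemma frac_integral_scale:
  assumes "0 < t"
  shows "frac_integral b \<phi> t = t powr b / Gamma b * (LINT x:{0..1}|lborel. (1 - x) powr (b - 1) * \<phi> (t * x))"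
proof -
  let ?F = "\<lambda>s. indicator {0..t} s *\<^sub>R ((t - s) powr (b - 1) * \<phi> s)"
  have ind: "indicator {0..t} (t * x) = (indicator {0..1} x :: real)" for x
    using assms by (auto simp: indicator_def zero_le_mult_iff)
  have "integral\<^sup>L lborel ?F = t * (LINT x|lborel. ?F (t * x))"
    using lborel_integral_real_affine[of t ?F 0] assms by simp
  also have "(LINT x|lborel. ?F (t * x)) =
      (LINT x|lborel. t powr (b - 1) * (indicator {0..1} x *\<^sub>R ((1 - x) powr (b - 1) * \<phi> (t * x))))"
  proof (rule Bochner_Integration.integral_cong[OF refl])
    fix x :: real
    have "(t - t * x) powr (b - 1) = t powr (b - 1) * (1 - x) powr (b - 1)" if "x \<in> {0..1}"
    proof -
      have "t - t * x = t * (1 - x)" by (simp add: algebra_simps)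
      then show ?thesis using that assms by (simp add: powr_mult)
    qed
    then show "?F (t * x) = t powr (b - 1) * (indicator {0..1} x *\<^sub>R ((1 - x) powr (b - 1) * \<phi> (t * x)))"
      unfolding ind by (auto simp: indicator_def)
  qed
  finally have "(LINT s:{0..t}|lborel. (t - s) powr (b - 1) * \<phi> s) =
      t * t powr (b - 1) * (LINT x:{0..1}|lborel. (1 - x) powr (b - 1) * \<phi> (t * x))"
    unfolding set_lebesgue_integral_def by simp
  moreover have "t * t powr (b - 1) = t powr b"
    using assms powr_mult_base[of t "b - 1"] by simp
  ultimately show ?thesis unfolding frac_integral_def by simp
qed

lemma frac_integral_0 [simp]: "frac_integral b \<phi> 0 = 0"
proof -
  have "(LINT s:{0..0}|lborel. (0 - s) powr (b - 1) * \<phi> s) = (LINT s:{0..0::real}|lborel. 0::real)"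
    by (intro set_lebesgue_integral_cong) auto
  then show ?thesis unfolding frac_integral_def by simp
qed

text \<open>In the scaled form the majorant is a multiple of the fixed kernel
  \<open>(1 - x) powr (b - 1)\<close>: a convergent sequence of times is bounded, so
  \<open>\<phi>\<close> is bounded on all points involved. The prefactor \<open>t powr b\<close> is
  continuous up to 0 because b > 0.\<close>

lemma continuous_on_frac_integral:
  assumes b: "0 < b" and \<phi>: "continuous_on {0..} \<phi>"
  shows "continuous_on {0..} (frac_integral b \<phi>)"
proof -
  let ?G = "\<lambda>t. t powr b / Gamma b * (LINT x:{0..1}|lborel. (1 - x) powr (b - 1) * \<phi> (t * x))"
  have "continuous_on {0..} (\<lambda>t. LINT x:{0..1}|lborel. (1 - x) powr (b - 1) * \<phi> (t * x))"
    unfolding continuous_on_sequentially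
  proof (intro ballI allI impI, elim conjE)
    fix t :: "nat \<Rightarrow> real" and t0
    assume t0: "t0 \<in> {0..}" and t: "\<forall>n. t n \<in> {0..}" and lim: "t \<longlonglongrightarrow> t0"
    obtain T where T: "\<And>n. t n \<le> T"
      using convergent_imp_Bseq[OF convergentI[OF lim]] unfolding Bseq_def
      by (metis abs_le_D1 real_norm_def)
    obtain M where M: "\<And>s. 0 \<le> s \<Longrightarrow> s \<le> T \<Longrightarrow> \<bar>\<phi> s\<bar> \<le> M"
      using continuous_on_halfline_bounded[OF \<phi>] by blast
    have M': "\<bar>\<phi> (t n * x)\<bar> \<le> M" if "0 \<le> x" "x \<le> 1" for n x
      using t T[of n] that mult_left_le[of x "t n"] by (intro M) fastforce+
    have meas: "(\<lambda>x. indicator {0..1} x *\<^sub>R ((1 - x) powr (b - 1) * \<phi> (r * x))) \<in> borel_measurable lborel"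
      if "0 \<le> r" for r
    proof -
      have "continuous_on {0..1} (\<lambda>x. \<phi> (r * x))"
        using that by (intro continuous_on_compose2[OF \<phi>] continuous_intros) auto
      then have "(\<lambda>x. indicator {0..1} x *\<^sub>R \<phi> (r * x)) \<in> borel_measurable borel"
        by (intro borel_measurable_continuous_on_indicator) auto
      then have "(\<lambda>x. (1 - x) powr (b - 1) * (indicator {0..1} x *\<^sub>R \<phi> (r * x))) \<in> borel_measurable lborel"
        by simp
      then show ?thesis by (simp add: ac_simps)
    qed
    have "(\<lambda>n. LINT x|lborel. indicator {0..1} x *\<^sub>R ((1 - x) powr (b - 1) * \<phi> (t n * x)))
        \<longlonglongrightarrow> (LINT x|lborel. indicator {0..1} x *\<^sub>R ((1 - x) powr (b - 1) * \<phi> (t0 * x)))"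
    proof (rule integral_dominated_convergence[where w = "\<lambda>x. indicator {0..1} x *\<^sub>R ((1 - x) powr (b - 1) * M)"])
      show "integrable lborel (\<lambda>x. indicator {0..1} x *\<^sub>R ((1 - x) powr (b - 1) * M))"
        using kernel_set_integrable[OF b, of 0 1]
        by (metis set_integrable_def set_integrable_mult_left)
      show "AE x in lborel. (\<lambda>n. indicator {0..1} x *\<^sub>R ((1 - x) powr (b - 1) * \<phi> (t n * x)))
          \<longlonglongrightarrow> indicator {0..1} x *\<^sub>R ((1 - x) powr (b - 1) * \<phi> (t0 * x))"
      proof (rule AE_I2)
        fix x :: real
        have "(\<lambda>n. \<phi> (t n * x)) \<longlonglongrightarrow> \<phi> (t0 * x)" if "0 \<le> x"
          using that t t0 by (intro continuous_on_tendsto_compose[OF \<phi>] tendsto_intros lim) auto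
        then show "(\<lambda>n. indicator {0..1} x *\<^sub>R ((1 - x) powr (b - 1) * \<phi> (t n * x)))
          \<longlonglongrightarrow> indicator {0..1} x *\<^sub>R ((1 - x) powr (b - 1) * \<phi> (t0 * x))"
          by (cases "0 \<le> x") (auto intro!: tendsto_intros)
      qed
      show "AE x in lborel. norm (indicator {0..1} x *\<^sub>R ((1 - x) powr (b - 1) * \<phi> (t n * x)))
          \<le> indicator {0..1} x *\<^sub>R ((1 - x) powr (b - 1) * M)" for n
        using M' by (intro AE_I2) (auto simp: indicator_def abs_mult intro!: mult_left_mono)
    qed (use meas t t0 in auto)
    then show "((\<lambda>t. LINT x:{0..1}|lborel. (1 - x) powr (b - 1) * \<phi> (t * x)) \<circ> t)
        \<longlonglongrightarrow> (LINT x:{0..1}|lborel. (1 - x) powr (b - 1) * \<phi> (t0 * x))"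
      by (simp add: set_lebesgue_integral_def comp_def)
  qed
  then have "continuous_on {0..} ?G"
    using b Gamma_real_pos[OF b] by (intro continuous_intros continuous_on_powr') (auto simp del: Gamma_real_pos)
  \<comment> \<open>The scaling formula needs 0 < t; at t = 0 both sides are 0, as
    \<open>0 powr b = 0\<close>.\<close>
  moreover have "frac_integral b \<phi> t = ?G t" if "t \<in> {0..}" for t
    using that b frac_integral_scale[of t b \<phi>] by (cases "t = 0") auto
  ultimately show ?thesis
    using continuous_on_cong by (metis (no_types, lifting))
qed

section \<open>Linear Volterra equations\<close>

lemma abs_frac_integral_le:
  assumes "0 < b" "kernel_integrable b \<phi> t" "kernel_integrable b \<psi> t"
    and "\<And>s. 0 \<le> s \<Longrightarrow> s \<le> t \<Longrightarrow> \<bar>\<phi> s\<bar> \<le> \<psi> s"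
  shows "\<bar>frac_integral b \<phi> t\<bar> \<le> frac_integral b \<psi> t"
proof -
  have "\<phi> s \<le> \<psi> s" "- \<psi> s \<le> \<phi> s" if "0 \<le> s" "s \<le> t" for s
    using assms(4)[OF that] by auto
  then show ?thesis
    using frac_integral_mono[OF assms(1-3)]
      frac_integral_mono[OF assms(1) kernel_integrable_uminus[OF assms(3)] assms(2)]
    by (simp add: frac_integral_uminus abs_le_iff)
qed

lemma kernel_exp_set_integrable:
  fixes b N t :: real
  assumes "0 < b" "0 \<le> N"
  shows "set_integrable lborel {0..t} (\<lambda>u. u powr (b - 1) * exp (- N * u))"
proof -
  have "set_integrable lborel {0..t} (\<lambda>s. (t - s) powr (b - 1) * exp (- N * (t - s)))"
    using assms
    by (intro kernel_mult_set_integrable[where B = 1] continuous_on_set_borel_measurable continuous_intros) auto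
  then show ?thesis
    by (subst (asm) set_integrable_lborel_reflect) simp
qed

text \<open>Up to the factor \<open>1 / Gamma b\<close>, this integral bounds the norm of the
  fractional integral on [0, T] in the weighted supremum norm with weight exp(-N t). The integrand
  tends to 0 at every u, also at u = 0, where \<open>powr\<close> takes the value 0.\<close>

lemma kernel_exp_tendsto_0:
  fixes b T :: real
  assumes b: "0 < b"
  shows "(\<lambda>n. LINT u:{0..T}|lborel. u powr (b - 1) * exp (- real n * u)) \<longlonglongrightarrow> 0"
proof -
  have "(\<lambda>n. LINT u|lborel. indicator {0..T} u *\<^sub>R (u powr (b - 1) * exp (- real n * u)))
      \<longlonglongrightarrow> (LINT (u::real)|lborel. 0)"
  proof (rule integral_dominated_convergence[where w = "\<lambda>u. indicator {0..T} u *\<^sub>R u powr (b - 1)"])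
    show "integrable lborel (\<lambda>u. indicator {0..T} u *\<^sub>R u powr (b - 1))"
      using powr_set_integrable[OF b] unfolding set_integrable_def .
    show "AE u in lborel. norm (indicator {0..T} u *\<^sub>R (u powr (b - 1) * exp (- real n * u)))
        \<le> indicator {0..T} u *\<^sub>R u powr (b - 1)" for n
      by (intro AE_I2) (auto simp: indicator_def intro!: mult_left_le)
    show "AE u in lborel. (\<lambda>n. indicator {0..T} u *\<^sub>R (u powr (b - 1) * exp (- real n * u))) \<longlonglongrightarrow> 0"
    proof (rule AE_I2)
      fix u :: real
      have "(\<lambda>n. u powr (b - 1) * exp (- real n * u)) \<longlonglongrightarrow> 0" if "0 < u"
      proof -
        have "(\<lambda>n. u powr (b - 1) * exp (- u) ^ n) \<longlonglongrightarrow> u powr (b - 1) * 0"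
          using that by (intro tendsto_mult_left LIMSEQ_realpow_zero) auto
        then show ?thesis by (simp add: exp_of_nat_mult[symmetric] mult_ac)
      qed
      then show "(\<lambda>n. indicator {0..T} u *\<^sub>R (u powr (b - 1) * exp (- real n * u))) \<longlonglongrightarrow> 0"
        by (cases "u = 0 \<or> u < 0") (auto simp: indicator_def)
    qed
  qed measurable
  then show ?thesis unfolding set_lebesgue_integral_def by simp
qed

text \<open>After reflection, exp(N (t - u)) factors, so the exponential is reproduced up to a
  constant. Enlarging the range of integration from t to T makes that constant independent of
  t.\<close>

lemma frac_integral_exp_le:
  fixes b N t T :: real
  assumes "0 < b" "0 \<le> N" "t \<le> T"
  shows "frac_integral b (\<lambda>s. exp (N * s)) t
      \<le> exp (N * t) * (1 / Gamma b * (LINT u:{0..T}|lborel. u powr (b - 1) * exp (- N * u)))"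
proof -
  have "frac_integral b (\<lambda>s. exp (N * s)) t
      = 1 / Gamma b * (LINT u:{0..t}|lborel. exp (N * t) * (u powr (b - 1) * exp (- N * u)))"
    unfolding frac_integral_reflect by (simp add: exp_diff exp_minus algebra_simps divide_inverse)
  also have "\<dots> = exp (N * t) * (1 / Gamma b * (LINT u:{0..t}|lborel. u powr (b - 1) * exp (- N * u)))"
    by simp
  also have "(LINT u:{0..t}|lborel. u powr (b - 1) * exp (- N * u))
      \<le> (LINT u:{0..T}|lborel. u powr (b - 1) * exp (- N * u))"
    unfolding set_lebesgue_integral_def
    using kernel_exp_set_integrable[OF assms(1,2)] assms(3)
    by (intro integral_mono) (auto simp: set_integrable_def indicator_def)
  finally show ?thesis
    using Gamma_real_pos[OF assms(1)] by (simp add: divide_right_mono)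
qed

text \<open>The terms \<open>y n\<close> are the n-fold images of g under c times the fractional
  integral. Their geometric bound depends on T, but the series itself does not, so its sum is a
  solution on the whole half-line. No sign of c is involved: the lemma yields both Y, with c = A,
  and the relaxation function.\<close>

lemma volterra_linear_exists:
  fixes g :: "real \<Rightarrow> real" and b c :: real
  assumes b: "0 < b" and g: "continuous_on {0..} g"
  obtains Y where "continuous_on {0..} Y" "\<And>t. 0 \<le> t \<Longrightarrow> Y t = g t + c * frac_integral b Y t"
proof -
  define y where "y = rec_nat g (\<lambda>n \<phi> t. c * frac_integral b \<phi> t)"
  have y0: "y 0 = g" and ySuc: "y (Suc n) = (\<lambda>t. c * frac_integral b (y n) t)" for n
    by (simp_all add: y_def)
  have cont: "continuous_on {0..} (y n)" for n
    by (induction n) (auto simp: y0 ySuc g intro!: continuous_intros continuous_on_frac_integral[OF b])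
  have bound: "\<exists>K. \<forall>n. \<forall>t\<in>{0..T}. \<bar>y n t\<bar> \<le> K * (1 / 2) ^ n" for T
  proof -
    obtain M where M: "0 \<le> M" "\<And>s. 0 \<le> s \<Longrightarrow> s \<le> T \<Longrightarrow> \<bar>g s\<bar> \<le> M"
      using continuous_on_halfline_bounded[OF g] by blast
    have "(\<lambda>n. \<bar>c\<bar> * (1 / Gamma b * (LINT u:{0..T}|lborel. u powr (b - 1) * exp (- real n * u))))
        \<longlonglongrightarrow> \<bar>c\<bar> * (1 / Gamma b * 0)"
      by (intro tendsto_intros kernel_exp_tendsto_0 b)
    then have "\<forall>\<^sub>F n in sequentially.
        \<bar>c\<bar> * (1 / Gamma b * (LINT u:{0..T}|lborel. u powr (b - 1) * exp (- real n * u))) < 1 / 2"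
      by (intro order_tendstoD(2)) auto
    then obtain N where N:
      "\<bar>c\<bar> * (1 / Gamma b * (LINT u:{0..T}|lborel. u powr (b - 1) * exp (- real N * u))) < 1 / 2"
      by (auto simp: eventually_sequentially)
    \<comment> \<open>With \<open>N\<close> large, the weight \<open>exp (N t)\<close> makes the integral operator a contraction on \<open>[0, T]\<close>.\<close>
    have *: "\<forall>t\<in>{0..T}. \<bar>y n t\<bar> \<le> M * (1 / 2) ^ n * exp (N * t)" for n
    proof (induction n)
      case 0
      show ?case
      proof
        fix t assume t: "t \<in> {0..T}"
        then have "\<bar>g t\<bar> \<le> M * 1" using M(2)[of t] by simp
        also have "\<dots> \<le> M * exp (N * t)" using t M(1) by (intro mult_left_mono) auto
        finally show "\<bar>y 0 t\<bar> \<le> M * (1 / 2) ^ 0 * exp (N * t)" by (simp add: y0)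
      qed
    next
      case (Suc n)
      show ?case
      proof
        fix t assume t: "t \<in> {0..T}"
        have "\<bar>frac_integral b (y n) t\<bar> \<le> frac_integral b (\<lambda>s. (M * (1 / 2) ^ n) * exp (N * s)) t"
          using Suc t
          by (intro abs_frac_integral_le b kernel_integrable_continuous cont continuous_intros) auto
        also have "\<dots> = (M * (1 / 2) ^ n) * frac_integral b (\<lambda>s. exp (N * s)) t"
          by (rule frac_integral_mult)
        also have "\<dots> \<le> (M * (1 / 2) ^ n) *
            (exp (N * t) * (1 / Gamma b * (LINT u:{0..T}|lborel. u powr (b - 1) * exp (- real N * u))))"
          using M(1) t by (intro mult_left_mono frac_integral_exp_le b) auto
        finally have "\<bar>c\<bar> * \<bar>frac_integral b (y n) t\<bar> \<le> \<bar>c\<bar> * ((M * (1 / 2) ^ n) *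
            (exp (N * t) * (1 / Gamma b * (LINT u:{0..T}|lborel. u powr (b - 1) * exp (- real N * u)))))"
          by (rule mult_left_mono) simp
        also have "\<dots> = (M * (1 / 2) ^ n * exp (N * t)) *
            (\<bar>c\<bar> * (1 / Gamma b * (LINT u:{0..T}|lborel. u powr (b - 1) * exp (- real N * u))))"
          by (simp only: mult_ac)
        also have "\<dots> \<le> (M * (1 / 2) ^ n * exp (N * t)) * (1 / 2)"
          using N M(1) by (intro mult_left_mono) auto
        finally show "\<bar>y (Suc n) t\<bar> \<le> M * (1 / 2) ^ Suc n * exp (N * t)"
          by (simp add: ySuc abs_mult)
      qed
    qed
    have "\<bar>y n t\<bar> \<le> (M * exp (N * T)) * (1 / 2) ^ n" if "t \<in> {0..T}" for n t
    proof -
      have "\<bar>y n t\<bar> \<le> M * (1 / 2) ^ n * exp (N * t)" using * that by blast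
      also have "\<dots> \<le> M * (1 / 2) ^ n * exp (N * T)"
        using that M(1) by (intro mult_left_mono) (auto intro: mult_left_mono)
      finally show ?thesis by (simp add: mult_ac)
    qed
    then show ?thesis by blast
  qed
  define Y where "Y t = (\<Sum>n. y n t)" for t
  have summable: "summable (\<lambda>n. y n t)" if "0 \<le> t" for t
  proof -
    obtain K where K: "\<forall>n. \<forall>s\<in>{0..t}. \<bar>y n s\<bar> \<le> K * (1 / 2) ^ n" using bound by blast
    show ?thesis
      by (rule summable_comparison_test'[of "\<lambda>n. K * (1 / 2) ^ n" 0])
        (use K that in \<open>auto intro!: summable_mult summable_geometric\<close>)
  qed
  have Y_cont: "continuous_on {0..} Y"
  proof -
    have "continuous_on {0..T} Y" for T
    proof -
      obtain K where K: "\<forall>n. \<forall>s\<in>{0..T}. \<bar>y n s\<bar> \<le> K * (1 / 2) ^ n" using bound by blast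
      have "uniform_limit {0..T} (\<lambda>n t. \<Sum>i<n. y i t) Y sequentially"
        unfolding Y_def using K
        by (intro Weierstrass_m_test[where M = "\<lambda>n. K * (1 / 2) ^ n"])
          (auto intro!: summable_mult summable_geometric)
      then show ?thesis
        by (rule uniform_limit_theorem[rotated])
          (auto intro!: always_eventually continuous_intros continuous_on_subset[OF cont])
    qed
    \<comment> \<open>At the right end of \<open>{0..T}\<close> continuity is only one-sided. On the
      relatively open piece below T the filter agrees with that of the half-line.\<close>
    then have *: "continuous_on ({0..} \<inter> {..<T}) Y" for T
      by (rule continuous_on_subset[of "{0..T}"]) auto
    show ?thesis
      unfolding continuous_on_eq_continuous_within
    proof
      fix t :: real assume t: "t \<in> {0..}"
      have "continuous (at t within {0..} \<inter> {..<t + 1}) Y"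
        using *[of "t + 1"] t by (auto simp: continuous_on_eq_continuous_within)
      moreover have "at t within {0..} = at t within {0..} \<inter> {..<t + 1}"
        by (rule at_within_nhd[of _ "{..<t + 1}"]) auto
      ultimately show "continuous (at t within {0..}) Y" by simp
    qed
  qed
  have "Y t = g t + c * frac_integral b Y t" if t: "0 \<le> t" for t
  proof -
    obtain K where K: "\<forall>n. \<forall>s\<in>{0..t}. \<bar>y n s\<bar> \<le> K * (1 / 2) ^ n" using bound by blast
    let ?P = "\<lambda>n s. \<Sum>i<n. y i s"
    \<comment> \<open>Applying the operator to a partial sum shifts its index by one; passing to the
      limit on both sides gives the equation.\<close>
    have P: "g t + c * frac_integral b (?P n) t = ?P (Suc n) t" for n
    proof -
      have "c * frac_integral b (?P n) t = (\<Sum>i<n. y (Suc i) t)"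
      proof (induction n)
        case 0 then show ?case using frac_integral_mult[of b 0 "\<lambda>_. 0" t] by simp
      next
        case (Suc n)
        then show ?case
          by (simp add: frac_integral_add kernel_integrable_continuous b cont continuous_on_sum ySuc
              distrib_left)
      qed
      then show ?thesis by (subst sum.lessThan_Suc_shift) (simp add: y0)
    qed
    have lim1: "(\<lambda>n. ?P n t) \<longlonglongrightarrow> Y t"
      unfolding Y_def using summable[OF t] by (rule summable_LIMSEQ)
    have lim2: "(\<lambda>n. frac_integral b (?P n) t) \<longlonglongrightarrow> frac_integral b Y t"
    proof -
      have "(\<lambda>n. LINT s|lborel. indicator {0..t} s *\<^sub>R ((t - s) powr (b - 1) * ?P n s))
          \<longlonglongrightarrow> (LINT s|lborel. indicator {0..t} s *\<^sub>R ((t - s) powr (b - 1) * Y s))"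
      proof (rule integral_dominated_convergence
          [where w = "\<lambda>s. indicator {0..t} s *\<^sub>R ((t - s) powr (b - 1) * (\<bar>K\<bar> * 2))"])
        show "integrable lborel (\<lambda>s. indicator {0..t} s *\<^sub>R ((t - s) powr (b - 1) * (\<bar>K\<bar> * 2)))"
          using set_integrable_mult_left[OF kernel_set_integrable[OF b, of 0 t]]
          unfolding set_integrable_def by blast
        have "(\<lambda>s. indicator {0..t} s *\<^sub>R ((t - s) powr (b - 1) * f s)) \<in> borel_measurable lborel"
          if "continuous_on {0..} f" for f :: "real \<Rightarrow> real"
          using kernel_integrable_continuous[OF b that]
          unfolding kernel_integrable_def set_integrable_def by (rule borel_measurable_integrable)
        then show "(\<lambda>s. indicator {0..t} s *\<^sub>R ((t - s) powr (b - 1) * Y s)) \<in> borel_measurable lborel"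
          "(\<lambda>s. indicator {0..t} s *\<^sub>R ((t - s) powr (b - 1) * ?P n s)) \<in> borel_measurable lborel" for n
          using Y_cont continuous_on_sum[of "{..<n}" "{0..}" y] cont by auto
        \<comment> \<open>\<open>K\<close> comes without a sign, hence its absolute value; 2 is the
          sum of the geometric series with ratio 1/2.\<close>
        have Pb: "\<bar>?P n s\<bar> \<le> \<bar>K\<bar> * 2" if "s \<in> {0..t}" for n s
        proof -
          have "\<bar>?P n s\<bar> \<le> (\<Sum>i<n. \<bar>K\<bar> * (1 / 2) ^ i)"
          proof (rule order_trans[OF sum_abs], rule sum_mono)
            fix i
            have "\<bar>y i s\<bar> \<le> K * (1 / 2) ^ i" using K that by blast
            also have "\<dots> \<le> \<bar>K\<bar> * (1 / 2) ^ i" by (intro mult_right_mono) auto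
            finally show "\<bar>y i s\<bar> \<le> \<bar>K\<bar> * (1 / 2) ^ i" .
          qed
          also have "\<dots> = \<bar>K\<bar> * (\<Sum>i<n. (1 / 2) ^ i)" by (simp add: sum_distrib_left)
          also have "(\<Sum>i<n. (1 / 2 :: real) ^ i) \<le> 2"
            by (simp add: sum_gp_strict)
          finally show ?thesis by (simp add: mult_left_mono)
        qed
        show "AE s in lborel. norm (indicator {0..t} s *\<^sub>R ((t - s) powr (b - 1) * ?P n s))
            \<le> indicator {0..t} s *\<^sub>R ((t - s) powr (b - 1) * (\<bar>K\<bar> * 2))" for n
          using Pb by (intro AE_I2) (auto simp: indicator_def abs_mult intro!: mult_left_mono)
        show "AE s in lborel. (\<lambda>n. indicator {0..t} s *\<^sub>R ((t - s) powr (b - 1) * ?P n s))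
            \<longlonglongrightarrow> indicator {0..t} s *\<^sub>R ((t - s) powr (b - 1) * Y s)"
        proof (rule AE_I2)
          fix s
          have "(\<lambda>n. ?P n s) \<longlonglongrightarrow> Y s" if "0 \<le> s"
            unfolding Y_def using summable[OF that] by (rule summable_LIMSEQ)
          then show "(\<lambda>n. indicator {0..t} s *\<^sub>R ((t - s) powr (b - 1) * ?P n s))
            \<longlonglongrightarrow> indicator {0..t} s *\<^sub>R ((t - s) powr (b - 1) * Y s)"
            by (cases "0 \<le> s") (auto intro!: tendsto_intros)
        qed
      qed
      then show ?thesis
        unfolding frac_integral_def set_lebesgue_integral_def by (intro tendsto_intros)
    qed
    have "(\<lambda>n. ?P (Suc n) t) \<longlonglongrightarrow> g t + c * frac_integral b Y t"
      unfolding P[symmetric] by (intro tendsto_intros lim2)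
    then show ?thesis
      using LIMSEQ_unique LIMSEQ_Suc[OF lim1] by blast
  qed
  with Y_cont that show ?thesis by blast
qed

section \<open>The Young integral\<close>

lemma halfline_at_within_Icc:
  fixes t :: real
  assumes "0 \<le> t"
  shows "at t within {0..} = at t within {0..t + 1}"
  by (rule at_within_nhd[of _ "{..<t + 1}"]) auto

lemma holder_imp_continuous_on:
  assumes "0 < \<gamma>" "holder_on_compacts \<gamma> g"
  shows "continuous_on {0..} g"
  unfolding continuous_on_def
proof
  fix t :: real assume t: "t \<in> {0..}"
  obtain K where K: "\<forall>s\<in>{0..t + 1}. \<forall>r\<in>{0..t + 1}. \<bar>g r - g s\<bar> \<le> K * \<bar>r - s\<bar> powr \<gamma>"
    using assms(2) t unfolding holder_on_compacts_def by (metis add_nonneg_nonneg atLeast_iff zero_le_one)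
  have "((\<lambda>s. K * \<bar>s - t\<bar> powr \<gamma>) \<longlongrightarrow> K * \<bar>t - t\<bar> powr \<gamma>) (at t within {0..t + 1})"
    using assms(1) by (intro tendsto_intros tendsto_powr') (auto simp: eventually_at_filter)
  then have "((\<lambda>s. K * \<bar>s - t\<bar> powr \<gamma>) \<longlongrightarrow> 0) (at t within {0..t + 1})"
    by simp
  then have "((\<lambda>s. g s - g t) \<longlongrightarrow> 0) (at t within {0..t + 1})"
    by (rule Lim_null_comparison[rotated]) (use K t in \<open>auto simp: eventually_at_filter\<close>)
  then show "(g \<longlongrightarrow> g t) (at t within {0..})"
    using t by (simp add: halfline_at_within_Icc LIM_zero_iff)
qed

section \<open>Partitions, uniqueness and integration by parts for the Young integral\<close>

lemma is_partition_le:
  assumes "is_partition a b n u" "i \<le> j" "j \<le> n"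
  shows "u i \<le> u j"
  using assms(2,3)
proof (induction rule: dec_induct)
  case (step k)
  then show ?case using assms(1) unfolding is_partition_def by (smt (verit) Suc_le_lessD le_SucI Suc_leD)
qed auto

text \<open>Partitions of arbitrarily small mesh keep the definition of the Young integral from
  being vacuous. For a = b the points cannot increase, so the partition has n = 0.\<close>

lemma uniform_partition:
  fixes a b \<eta> :: real
  assumes "a \<le> b" "0 < \<eta>"
  obtains n u where "is_partition a b n u" "\<And>i. i < n \<Longrightarrow> u (Suc i) - u i < \<eta>"
proof (cases "a = b")
  case True
  show ?thesis by (rule that[of 0 "\<lambda>_. a"]) (auto simp: is_partition_def True)
next
  case False
  then have ab: "a < b" using assms by simp
  obtain n where n: "(b - a) / \<eta> < real n" using reals_Archimedean2 by blast
  then have n0: "0 < real n" using ab assms by (meson divide_pos_pos less_trans diff_gt_0_iff_gt)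
  define u where "u i = a + real i * ((b - a) / n)" for i :: nat
  have d: "u (Suc i) - u i = (b - a) / n" for i
    unfolding u_def by (simp only: of_nat_Suc distrib_right)
  have "u i < u (Suc i)" for i using d[of i] ab n0 by (metis diff_gt_0_iff_gt divide_pos_pos)
  then have "is_partition a b n u" using n0 by (auto simp: is_partition_def u_def)
  moreover have "(b - a) / n < \<eta>" using n n0 assms by (simp add: field_simps)
  ultimately show ?thesis using that d by auto
qed

text \<open>Each of the two solution relations asserts its own Young integral; uniqueness identifies
  them, so that they cancel in X - Y.\<close>

lemma has_young_integral_unique:
  assumes "a \<le> b" and I: "has_young_integral \<phi> \<theta> a b I" and J: "has_young_integral \<phi> \<theta> a b J"
  shows "I = J"
proof (rule ccontr)
  assume "I \<noteq> J"
  define e where "e = \<bar>I - J\<bar> / 2"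
  have "0 < e" using \<open>I \<noteq> J\<close> by (simp add: e_def)
  let ?S = "\<lambda>n u. \<Sum>i<n. \<phi> (u i) * (\<theta> (u (Suc i)) - \<theta> (u i))"
  obtain \<eta>1 where 1: "0 < \<eta>1" "\<And>n u. is_partition a b n u \<and> (\<forall>i<n. u (Suc i) - u i < \<eta>1) \<Longrightarrow> \<bar>?S n u - I\<bar> < e"
    using I[unfolded has_young_integral_def, rule_format, OF \<open>0 < e\<close>] by (elim exE conjE) blast
  obtain \<eta>2 where 2: "0 < \<eta>2" "\<And>n u. is_partition a b n u \<and> (\<forall>i<n. u (Suc i) - u i < \<eta>2) \<Longrightarrow> \<bar>?S n u - J\<bar> < e"
    using J[unfolded has_young_integral_def, rule_format, OF \<open>0 < e\<close>] by (elim exE conjE) blast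
  obtain n u where u: "is_partition a b n u" "\<And>i. i < n \<Longrightarrow> u (Suc i) - u i < min \<eta>1 \<eta>2"
    using uniform_partition[OF \<open>a \<le> b\<close>, of "min \<eta>1 \<eta>2"] 1(1) 2(1) by auto
  have "\<bar>?S n u - I\<bar> < e" "\<bar>?S n u - J\<bar> < e"
    using u by (intro 1(2) 2(2); auto)+
  moreover have "2 * e = \<bar>I - J\<bar>" by (simp add: e_def)
  moreover have "\<not> (\<bar>x - I\<bar> < e \<and> \<bar>x - J\<bar> < e \<and> 2 * e = \<bar>I - J\<bar>)" for x by arith
  ultimately show False by blast
qed

lemma set_integral_partition_sum:
  fixes \<psi> :: "real \<Rightarrow> real"
  assumes "is_partition a b n u" "set_integrable lborel {a..b} \<psi>" "m \<le> n"
  shows "(\<Sum>i<m. LINT s:{u i..u (Suc i)}|lborel. \<psi> s) = (LINT s:{a..u m}|lborel. \<psi> s)"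
  using assms(3)
proof (induction m)
  case 0
  have "(LINT s:{a..u 0}|lborel. \<psi> s) = (LINT s:{a}|lborel. \<psi> s)"
    using assms(1) by (simp add: is_partition_def)
  also have "\<dots> = 0"
    unfolding set_lebesgue_integral_def using AE_lborel_singleton[of a]
    by (intro integral_eq_zero_AE) auto
  finally show ?case by simp
next
  case (Suc m)
  have le: "a \<le> u m" "u m \<le> u (Suc m)" "u (Suc m) \<le> b"
    using is_partition_le[OF assms(1), of 0 m] is_partition_le[OF assms(1), of m "Suc m"]
      is_partition_le[OF assms(1), of "Suc m" n] Suc.prems assms(1) by (auto simp: is_partition_def)
  have "set_integrable lborel {a..u (Suc m)} \<psi>"
    using le by (intro set_integrable_subset[OF assms(2)]) auto
  then show ?case using Suc set_integral_Icc_split[OF le(1,2)] by simp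
qed

text \<open>Left-point sums for p turn into right-point sums for q, which is why right end points
  appear in the error estimate of the integration by parts.\<close>

lemma summation_by_parts:
  fixes p q :: "nat \<Rightarrow> real"
  shows "(\<Sum>i<n. p i * (q (Suc i) - q i)) = p n * q n - p 0 * q 0 - (\<Sum>i<n. q (Suc i) * (p (Suc i) - p i))"
  by (induction n) (auto simp: algebra_simps)

text \<open>Summation by parts moves the increments onto \<open>\<phi>\<close>, where they are
  integrals of \<open>\<psi>\<close>. On each cell, \<open>\<theta>\<close> at the right end point
  differs from \<open>\<theta> s\<close> by less than a modulus w, so the total error is at most w
  times the integral of |\<open>\<psi>\<close>|. Integrability of \<open>\<psi>\<close> is the
  natural requirement, as the derivative of a fractional kernel may blow up at t.\<close>

lemma has_young_integral_by_parts:
  fixes \<phi> \<psi> \<theta> :: "real \<Rightarrow> real"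
  assumes "0 \<le> t" and \<theta>: "continuous_on {0..t} \<theta>" and \<psi>: "set_integrable lborel {0..t} \<psi>"
    and FTC: "\<And>a b. 0 \<le> a \<Longrightarrow> a \<le> b \<Longrightarrow> b \<le> t \<Longrightarrow> (LINT s:{a..b}|lborel. \<psi> s) = \<phi> b - \<phi> a"
  shows "has_young_integral \<phi> \<theta> 0 t (\<phi> t * \<theta> t - \<phi> 0 * \<theta> 0 - (LINT s:{0..t}|lborel. \<theta> s * \<psi> s))"
  unfolding has_young_integral_def
proof (intro allI impI)
  fix e :: real assume "0 < e"
  define N where "N = (LINT s:{0..t}|lborel. \<bar>\<psi> s\<bar>)"
  have N0: "0 \<le> N"
    unfolding N_def set_lebesgue_integral_def by (intro integral_nonneg_AE) auto
  \<comment> \<open>The total error is w N; the summand 1 makes this strictly less than e and covers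
    N = 0.\<close>
  define w where "w = e / (N + 1)"
  have w0: "0 < w" using N0 \<open>0 < e\<close> by (simp add: w_def)
  have "uniformly_continuous_on {0..t} \<theta>"
    using \<theta> by (intro compact_uniformly_continuous) auto
  then obtain \<eta> where \<eta>: "0 < \<eta>" "\<And>x y. x \<in> {0..t} \<Longrightarrow> y \<in> {0..t} \<Longrightarrow> \<bar>y - x\<bar> < \<eta> \<Longrightarrow> \<bar>\<theta> y - \<theta> x\<bar> < w"
    using w0 unfolding uniformly_continuous_on_def dist_real_def by (elim allE[of _ w]) auto
  have \<theta>\<psi>: "set_integrable lborel {0..t} (\<lambda>s. \<theta> s * \<psi> s)"
  proof -
    obtain M where M: "\<And>s. s \<in> {0..t} \<Longrightarrow> \<bar>\<theta> s\<bar> \<le> M"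
      using compact_imp_bounded[OF compact_continuous_image[OF \<theta> compact_Icc]]
      unfolding bounded_iff by fastforce
    have "(\<lambda>s. (indicator {0..t} s *\<^sub>R \<theta> s) * (indicator {0..t} s *\<^sub>R \<psi> s)) \<in> borel_measurable lborel"
      using \<psi> borel_measurable_continuous_on_indicator[OF _ \<theta>]
      unfolding set_integrable_def by (intro borel_measurable_times) auto
    moreover have "(indicator {0..t} s *\<^sub>R \<theta> s) * (indicator {0..t} s *\<^sub>R \<psi> s) =
        indicator {0..t} s *\<^sub>R (\<theta> s * \<psi> s)" for s
      by (auto simp: indicator_def)
    ultimately have "set_borel_measurable lborel {0..t} (\<lambda>s. \<theta> s * \<psi> s)"
      unfolding set_borel_measurable_def by (simp only:)
    then show ?thesis
    proof (rule set_integrable_bound[where f = "\<lambda>s. M * \<psi> s", rotated])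
      show "set_integrable lborel {0..t} (\<lambda>s. M * \<psi> s)" using \<psi> by simp
      show "AE x in lborel. x \<in> {0..t} \<longrightarrow> norm (\<theta> x * \<psi> x) \<le> norm (M * \<psi> x)"
        using M by (intro AE_I2) (force simp: abs_mult intro!: mult_right_mono)
    qed
  qed
  show "\<exists>\<eta>>0. \<forall>n u. is_partition 0 t n u \<and> (\<forall>i<n. u (Suc i) - u i < \<eta>) \<longrightarrow>
      \<bar>(\<Sum>i<n. \<phi> (u i) * (\<theta> (u (Suc i)) - \<theta> (u i)))
        - (\<phi> t * \<theta> t - \<phi> 0 * \<theta> 0 - (LINT s:{0..t}|lborel. \<theta> s * \<psi> s))\<bar> < e"
  proof (intro exI[of _ \<eta>] conjI \<eta>(1) allI impI, elim conjE)
    fix n u assume u: "is_partition 0 t n u" and mesh: "\<forall>i<n. u (Suc i) - u i < \<eta>"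
    have ends: "u 0 = 0" "u n = t" using u by (auto simp: is_partition_def)
    have rng: "0 \<le> u i" "u i \<le> u (Suc i)" "u (Suc i) \<le> t" if "i < n" for i
      using that is_partition_le[OF u, of 0 i] is_partition_le[OF u, of i "Suc i"]
        is_partition_le[OF u, of "Suc i" n] ends by auto
    have sub: "set_integrable lborel {u i..u (Suc i)} f" if "i < n" "set_integrable lborel {0..t} (f :: real \<Rightarrow> real)"
      for i f
      using rng[OF that(1)] by (intro set_integrable_subset[OF that(2)]) auto
    have "(\<Sum>i<n. \<theta> (u (Suc i)) * (\<phi> (u (Suc i)) - \<phi> (u i)))
        = (\<Sum>i<n. LINT s:{u i..u (Suc i)}|lborel. \<theta> (u (Suc i)) * \<psi> s)"
      using rng by (intro sum.cong) (auto simp: FTC)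
    moreover have "(LINT s:{0..t}|lborel. \<theta> s * \<psi> s) = (\<Sum>i<n. LINT s:{u i..u (Suc i)}|lborel. \<theta> s * \<psi> s)"
      using set_integral_partition_sum[OF u \<theta>\<psi> order_refl] ends by simp
    ultimately have "\<bar>(\<Sum>i<n. \<phi> (u i) * (\<theta> (u (Suc i)) - \<theta> (u i)))
        - (\<phi> t * \<theta> t - \<phi> 0 * \<theta> 0 - (LINT s:{0..t}|lborel. \<theta> s * \<psi> s))\<bar>
      = \<bar>(\<Sum>i<n. (LINT s:{u i..u (Suc i)}|lborel. \<theta> s * \<psi> s) -
            (LINT s:{u i..u (Suc i)}|lborel. \<theta> (u (Suc i)) * \<psi> s))\<bar>"
      using summation_by_parts[of "\<lambda>i. \<phi> (u i)" "\<lambda>i. \<theta> (u i)" n] ends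
      by (simp add: sum_subtractf)
    also have "\<dots> \<le> (\<Sum>i<n. w * (LINT s:{u i..u (Suc i)}|lborel. \<bar>\<psi> s\<bar>))"
    proof (rule order_trans[OF sum_abs], rule sum_mono)
      fix i assume "i \<in> {..<n}"
      then have i: "i < n" by simp
      have int: "set_integrable lborel {u i..u (Suc i)} (\<lambda>s. \<theta> s * \<psi> s)"
        "set_integrable lborel {u i..u (Suc i)} (\<lambda>s. \<theta> (u (Suc i)) * \<psi> s)"
        "set_integrable lborel {u i..u (Suc i)} (\<lambda>s. \<bar>\<psi> s\<bar>)"
        using sub[OF i] \<theta>\<psi> \<psi> by (auto intro: set_integrable_abs)
      have diff: "\<bar>\<theta> s * \<psi> s - \<theta> (u (Suc i)) * \<psi> s\<bar> \<le> w * \<bar>\<psi> s\<bar>" if "s \<in> {u i..u (Suc i)}" for s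
      proof -
        have "\<bar>\<theta> s - \<theta> (u (Suc i))\<bar> < w"
          using \<eta>(2)[of "u (Suc i)" s] rng[OF i] mesh i that by force
        then show ?thesis
          by (simp add: left_diff_distrib[symmetric] abs_mult mult_right_mono)
      qed
      have "\<bar>(LINT s:{u i..u (Suc i)}|lborel. \<theta> s * \<psi> s) - (LINT s:{u i..u (Suc i)}|lborel. \<theta> (u (Suc i)) * \<psi> s)\<bar>
          = norm (LINT s:{u i..u (Suc i)}|lborel. \<theta> s * \<psi> s - \<theta> (u (Suc i)) * \<psi> s)"
        using int by (simp add: set_integral_diff)
      also have "\<dots> \<le> (LINT s:{u i..u (Suc i)}|lborel. w * \<bar>\<psi> s\<bar>)"
        unfolding set_lebesgue_integral_def
      proof (rule Bochner_Integration.integral_norm_bound_integral)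
        show "integrable lborel (\<lambda>x. indicator {u i..u (Suc i)} x *\<^sub>R (\<theta> x * \<psi> x - \<theta> (u (Suc i)) * \<psi> x))"
          using set_integral_diff(1)[OF int(1,2)] unfolding set_integrable_def .
        show "integrable lborel (\<lambda>x. indicator {u i..u (Suc i)} x *\<^sub>R (w * \<bar>\<psi> x\<bar>))"
          using set_integrable_mult_right[OF int(3)] unfolding set_integrable_def by blast
      qed (use diff in \<open>auto simp: indicator_def\<close>)
      finally show "\<bar>(LINT s:{u i..u (Suc i)}|lborel. \<theta> s * \<psi> s) -
            (LINT s:{u i..u (Suc i)}|lborel. \<theta> (u (Suc i)) * \<psi> s)\<bar>
          \<le> w * (LINT s:{u i..u (Suc i)}|lborel. \<bar>\<psi> s\<bar>)" by simp
    qed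
    also have "\<dots> = w * N"
      using set_integral_partition_sum[OF u set_integrable_abs[OF \<psi>] order_refl] ends
      by (simp add: sum_distrib_left[symmetric] N_def)
    also have "\<dots> < e"
      using N0 \<open>0 < e\<close> unfolding w_def by (simp add: divide_less_eq)
    finally show "\<bar>(\<Sum>i<n. \<phi> (u i) * (\<theta> (u (Suc i)) - \<theta> (u i)))
        - (\<phi> t * \<theta> t - \<phi> 0 * \<theta> 0 - (LINT s:{0..t}|lborel. \<theta> s * \<psi> s))\<bar> < e" .
  qed
qed

text \<open>Both boundary terms vanish: the kernel at s = t, and \<open>\<theta>\<close> at 0. The
  derivative of the integrator \<open>\<phi>\<close> has a part with f', giving order \<alpha>, and
  a part in which the kernel is differentiated, giving order \<alpha> - 1; the latter is integrable
  because \<alpha> > 1. The recursion Gamma(\<alpha>) = (\<alpha> - 1) Gamma(\<alpha> - 1)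
  normalizes it.\<close>

lemma has_young_integral_frac_kernel:
  fixes \<alpha> t :: real
  assumes \<alpha>: "1 < \<alpha>" and t: "0 \<le> t" and f: "C1_halfline f" and \<theta>: "continuous_on {0..} \<theta>" "\<theta> 0 = 0"
  shows "has_young_integral (\<lambda>s. (t - s) powr (\<alpha> - 1) * f s) \<theta> 0 t
    (Gamma \<alpha> * (frac_integral (\<alpha> - 1) (\<lambda>s. f s * \<theta> s) t - frac_integral \<alpha> (\<lambda>s. halfline_deriv f s * \<theta> s) t))"
proof -
  define f' where "f' = halfline_deriv f"
  have f'_cont: "continuous_on {0..} f'"
    using f unfolding C1_halfline_def f'_def by auto
  have df: "(f has_real_derivative f' s) (at s within {0..})" if "0 \<le> s" for s
    using f that unfolding C1_halfline_def f'_def by auto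
  have f_cont: "continuous_on {0..} f"
    using df by (intro DERIV_continuous_on) auto
  define \<phi> where "\<phi> s = (t - s) powr (\<alpha> - 1) * f s" for s
  define \<psi> where "\<psi> s = (t - s) powr (\<alpha> - 1) * f' s - (\<alpha> - 1) * ((t - s) powr (\<alpha> - 1 - 1) * f s)" for s
  have ki: "kernel_integrable \<alpha> f' t" "kernel_integrable (\<alpha> - 1) f t"
    using \<alpha> by (auto intro!: kernel_integrable_continuous f'_cont f_cont)
  have \<psi>: "set_integrable lborel {0..t} \<psi>"
    unfolding \<psi>_def using ki unfolding kernel_integrable_def
    by (intro set_integral_diff set_integrable_mult_right) auto
  have \<phi>_cont: "continuous_on {0..t} \<phi>"
    unfolding \<phi>_def using \<alpha>
    by (intro continuous_intros continuous_on_powr' continuous_on_subset[OF f_cont]) auto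
  have FTC: "(LINT s:{a..b}|lborel. \<psi> s) = \<phi> b - \<phi> a" if ab: "0 \<le> a" "a \<le> b" "b \<le> t" for a b
  proof -
    have "(\<psi> has_integral \<phi> b - \<phi> a) {a..b}"
    \<comment> \<open>The power may fail to be differentiable at s = t, and at 0 only the one-sided
      derivative of f is given, so differentiability is used in the interior and continuity up to
      the ends.\<close>
    proof (rule fundamental_theorem_of_calculus_interior[OF ab(2)])
      show "continuous_on {a..b} \<phi>" using ab by (intro continuous_on_subset[OF \<phi>_cont]) auto
      fix s assume s: "s \<in> {a<..<b}"
      have f_at: "(f has_real_derivative f' s) (at s)"
        using df[of s] s ab at_within_interior[of s "{0..}"] by (auto simp: interior_Ici)
      have "((\<lambda>x. t - x) has_real_derivative - 1) (at s)"
        by (auto intro!: derivative_eq_intros)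
      then have "((\<lambda>x. (t - x) powr (\<alpha> - 1)) has_real_derivative
          ((\<alpha> - 1) * (t - s) powr (\<alpha> - 1 - 1)) * - 1) (at s)"
        using s ab by (intro DERIV_chain2[OF has_real_derivative_powr]) auto
      from DERIV_mult[OF this f_at] have "(\<phi> has_real_derivative \<psi> s) (at s)"
        unfolding \<phi>_def \<psi>_def by (rule DERIV_cong) (simp add: algebra_simps)
      then show "(\<phi> has_vector_derivative \<psi> s) (at s)"
        by (simp add: has_real_derivative_iff_has_vector_derivative)
    qed
    moreover have "set_integrable lborel {a..b} \<psi>"
      using ab by (intro set_integrable_subset[OF \<psi>]) auto
    ultimately show ?thesis
      using set_borel_integral_eq_integral(2) by (metis integral_unique)
  qed
  have cont: "continuous_on {0..t} \<theta>" by (rule continuous_on_subset[OF \<theta>(1)]) auto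
  have "has_young_integral \<phi> \<theta> 0 t (\<phi> t * \<theta> t - \<phi> 0 * \<theta> 0 - (LINT s:{0..t}|lborel. \<theta> s * \<psi> s))"
    using t cont \<psi> FTC by (rule has_young_integral_by_parts)
  moreover have "(LINT s:{0..t}|lborel. \<theta> s * \<psi> s)
      = - (Gamma \<alpha> * (frac_integral (\<alpha> - 1) (\<lambda>s. f s * \<theta> s) t - frac_integral \<alpha> (\<lambda>s. f' s * \<theta> s) t))"
  proof -
    have "kernel_integrable \<alpha> (\<lambda>s. f' s * \<theta> s) t" "kernel_integrable (\<alpha> - 1) (\<lambda>s. f s * \<theta> s) t"
      using \<alpha> by (auto intro!: kernel_integrable_continuous continuous_intros f'_cont f_cont \<theta>)
    then have "(LINT s:{0..t}|lborel. (t - s) powr (\<alpha> - 1) * (f' s * \<theta> s)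
          - (\<alpha> - 1) * ((t - s) powr (\<alpha> - 1 - 1) * (f s * \<theta> s)))
        = Gamma \<alpha> * frac_integral \<alpha> (\<lambda>s. f' s * \<theta> s) t
          - (\<alpha> - 1) * (Gamma (\<alpha> - 1) * frac_integral (\<alpha> - 1) (\<lambda>s. f s * \<theta> s) t)"
      unfolding kernel_integrable_def frac_integral_def using \<alpha> Gamma_real_pos[of \<alpha>] Gamma_real_pos[of "\<alpha> - 1"]
      by (subst set_integral_diff) (auto simp del: Gamma_real_pos)
    moreover have "Gamma \<alpha> = (\<alpha> - 1) * Gamma (\<alpha> - 1)"
      using Gamma_plus1[of "\<alpha> - 1"] \<alpha> nonpos_Ints_nonpos[of "\<alpha> - 1"] by fastforce
    then have "(\<alpha> - 1) * (Gamma (\<alpha> - 1) * x) = Gamma \<alpha> * x" for x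
      by simp
    moreover have "\<theta> s * \<psi> s = (t - s) powr (\<alpha> - 1) * (f' s * \<theta> s)
          - (\<alpha> - 1) * ((t - s) powr (\<alpha> - 1 - 1) * (f s * \<theta> s))" for s
      unfolding \<psi>_def by (simp add: algebra_simps)
    ultimately show ?thesis by (simp only: right_diff_distrib minus_diff_eq)
  qed
  moreover have "\<phi> t = 0" by (simp add: \<phi>_def)
  ultimately show ?thesis using \<theta>(2) unfolding \<phi>_def[abs_def] f'_def by simp
qed

section \<open>Positivity and comparison\<close>

text \<open>This is log-convexity of the kernel: (t' - s) / (t - s) is at least t' / t, and the
  exponent b - 1 is not positive, so the kernel ratio is largest at s = 0.\<close>

lemma kernel_ratio_le:
  fixes b s t t' :: real
  assumes "b \<le> 1" "0 \<le> s" "s < t" "t \<le> t'"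
  shows "(t' - s) powr (b - 1) \<le> (t' / t) powr (b - 1) * (t - s) powr (b - 1)"
proof -
  have pos: "0 < t" "0 < t'" using assms by auto
  have "(t' / t) * (t - s) \<le> t' - s"
    using assms pos by (simp add: field_simps mult_left_mono)
  then have "(t' - s) powr (b - 1) \<le> ((t' / t) * (t - s)) powr (b - 1)"
    using assms pos by (intro powr_mono2') auto
  also have "\<dots> = (t' / t) powr (b - 1) * (t - s) powr (b - 1)"
    by (rule powr_mult)
  finally show ?thesis .
qed

text \<open>The zeros in [0, t] form a closed set, nonempty by the intermediate value theorem; its
  infimum works, since a nonpositive value before it would produce an earlier zero.\<close>

lemma first_zero:
  fixes D :: "real \<Rightarrow> real"
  assumes D: "continuous_on {0..} D" "0 < D 0" and t: "0 \<le> t" "D t \<le> 0"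
  obtains t0 where "0 < t0" "D t0 = 0" "\<And>s. 0 \<le> s \<Longrightarrow> s < t0 \<Longrightarrow> 0 < D s"
proof -
  let ?Z = "{s \<in> {0..t}. D s = 0}"
  have "continuous_on {0..t} D" by (rule continuous_on_subset[OF D(1)]) auto
  then have "closed ?Z"
    by (intro continuous_closed_preimage_constant) auto
  moreover have zero: "\<exists>x\<ge>0. x \<le> r \<and> D x = 0" if "0 \<le> r" "D r \<le> 0" for r
    using IVT2'[of D r 0 0] that D continuous_on_subset[OF D(1), of "{0..r}"] by auto
  then have "?Z \<noteq> {}" using t by auto
  moreover have bdd: "bdd_below ?Z" by (intro bdd_belowI[of _ 0]) auto
  ultimately have in_Z: "Inf ?Z \<in> ?Z" by (intro closed_contains_Inf)
  show ?thesis
  proof (rule that[of "Inf ?Z"])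
    show "D (Inf ?Z) = 0" using in_Z by auto
    then show "0 < Inf ?Z" using in_Z D(2) by (cases "Inf ?Z = 0") auto
    fix s assume s: "0 \<le> s" "s < Inf ?Z"
    show "0 < D s"
    proof (rule ccontr)
      assume "\<not> 0 < D s"
      then obtain x where x: "0 \<le> x" "x \<le> s" "D x = 0" using zero[of s] s by auto
      then have "x \<in> ?Z" using s in_Z by auto
      then have "Inf ?Z \<le> x" using bdd by (intro cInf_lower)
      then show False using x s by simp
    qed
  qed
qed

text \<open>At a first zero \<open>t0\<close> of \<open>D\<close>, \<open>kernel_ratio_le\<close> compares the memory term with that at an earlier
  time \<open>r\<close>. Taking for \<open>r\<close> the maximum point of \<open>D\<close> on a short interval before \<open>t0\<close>, the contribution of
  \<open>[r, t0]\<close> is at most \<open>D r / 2\<close>, too small for \<open>D\<close> to reach \<open>0\<close>.\<close>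

lemma volterra_positive:
  fixes D g :: "real \<Rightarrow> real" and b c :: real
  assumes b: "0 < b" "b \<le> 1" and c: "0 \<le> c"
    and D: "continuous_on {0..} D" "0 < D 0"
    and eq: "\<And>t. 0 \<le> t \<Longrightarrow> D t = g t - c * (LINT s:{0..t}|lborel. (t - s) powr (b - 1) * D s)"
    and mono: "\<And>t t'. 0 < t \<Longrightarrow> t \<le> t' \<Longrightarrow> (t' / t) powr (b - 1) * g t \<le> g t'"
    and t: "0 \<le> t"
  shows "0 < D t"
proof (rule ccontr)
  assume "\<not> 0 < D t"
  then obtain t0 where t0: "0 < t0" "D t0 = 0" and pos: "\<And>s. 0 \<le> s \<Longrightarrow> s < t0 \<Longrightarrow> 0 < D s"
    using first_zero[OF D t] by auto
  have D_int: "set_integrable lborel {0..r} (\<lambda>s. (r - s) powr (b - 1) * D s)" for r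
    using kernel_integrable_continuous[OF b(1) D(1)] unfolding kernel_integrable_def .
  \<comment> \<open>The bound \<open>t0 / 2\<close> keeps r at least half of t0, whence \<rho> is at
    least 1/2. The other bound gives \<open>c * (d powr b / b)\<close> at most c / (4 (c + 1)),
    below 1/4; the summand 1 allows c = 0.\<close>
  define d where "d = min (t0 / 2) ((b / (4 * (c + 1))) powr (1 / b))"
  have d: "0 < d" "d \<le> t0 / 2" using t0 b c by (auto simp: d_def)
  have d_small: "c * (r powr b / b) < 1 / 2" if "0 \<le> r" "r \<le> d" for r
  proof -
    have "r powr b \<le> ((b / (4 * (c + 1))) powr (1 / b)) powr b"
      using that b unfolding d_def by (intro powr_mono2) auto
    also have "\<dots> = b / (4 * (c + 1))" using b c by (simp add: powr_powr)
    finally have "c * (r powr b / b) \<le> c * (b / (4 * (c + 1)) / b)"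
      using b c by (intro mult_left_mono divide_right_mono) auto
    also have "\<dots> = c / (4 * (c + 1))" using b by simp
    also have "\<dots> < 1 / 2" using c by (simp add: field_simps)
    finally show ?thesis .
  qed
  have "\<exists>x\<in>{t0 - d..t0}. \<forall>y\<in>{t0 - d..t0}. D y \<le> D x"
    using d t0 by (intro continuous_attains_sup continuous_on_subset[OF D(1)]) auto
  then obtain r where r: "t0 - d \<le> r" "r \<le> t0" and max: "\<And>y. t0 - d \<le> y \<Longrightarrow> y \<le> t0 \<Longrightarrow> D y \<le> D r"
    by auto
  have "0 < D (t0 - d)" using d t0 by (intro pos) auto
  then have Dr: "0 < D r" using max[of "t0 - d"] d by auto
  then have r_less: "r < t0" using r t0 by (cases "r = t0") auto
  have r_pos: "0 < r" using r d t0 by auto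
  \<comment> \<open>This is the kernel ratio at s = 0 for the times r and t0, and also the factor by
    which the hypothesis \<open>mono\<close> lets g decrease. It equals (r / t0) to the power 1 - b,
    hence is at least r / t0.\<close>
  define \<rho> where "\<rho> = (t0 / r) powr (b - 1)"
  have "1 / 2 \<le> r / t0" using r d t0 by (simp add: field_simps)
  also have "\<dots> \<le> (r / t0) powr (1 - b)"
    using powr_mono'[of "1 - b" 1 "r / t0"] r_pos r_less t0 b by simp
  also have "\<dots> = \<rho>"
    unfolding \<rho>_def using r_pos t0 powr_minus_divide[of "t0 / r" "1 - b"]
    by (simp add: powr_divide)
  finally have \<rho>: "1 / 2 \<le> \<rho>" .
  have "(LINT s:{0..t0}|lborel. (t0 - s) powr (b - 1) * D s) =
      (LINT s:{0..r}|lborel. (t0 - s) powr (b - 1) * D s) +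
      (LINT s:{r..t0}|lborel. (t0 - s) powr (b - 1) * D s)"
    using r_pos r_less D_int by (intro set_integral_Icc_split) auto
  also have "(LINT s:{0..r}|lborel. (t0 - s) powr (b - 1) * D s)
      \<le> (LINT s:{0..r}|lborel. \<rho> * ((r - s) powr (b - 1) * D s))"
  proof (rule set_integral_mono_AE)
    show "set_integrable lborel {0..r} (\<lambda>s. (t0 - s) powr (b - 1) * D s)"
      using r_pos r_less by (auto intro!: set_integrable_subset[OF D_int])
    show "set_integrable lborel {0..r} (\<lambda>s. \<rho> * ((r - s) powr (b - 1) * D s))"
      using D_int by simp
    show "AE s\<in>{0..r} in lborel. (t0 - s) powr (b - 1) * D s \<le> \<rho> * ((r - s) powr (b - 1) * D s)"
      using AE_lborel_singleton[of r]
    proof eventually_elim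
      case (elim s)
      show ?case
      proof
        assume "s \<in> {0..r}"
        then have s: "0 \<le> s" "s < r" using elim by auto
        then have "(t0 - s) powr (b - 1) * D s \<le> (\<rho> * (r - s) powr (b - 1)) * D s"
          using kernel_ratio_le[of b s r t0] pos[of s] r_less b
          by (intro mult_right_mono) (auto simp: \<rho>_def)
        then show "(t0 - s) powr (b - 1) * D s \<le> \<rho> * ((r - s) powr (b - 1) * D s)" by (simp only: mult.assoc)
      qed
    qed
  qed
  also have "(LINT s:{r..t0}|lborel. (t0 - s) powr (b - 1) * D s)
      \<le> (LINT s:{r..t0}|lborel. (t0 - s) powr (b - 1) * D r)"
  proof (rule set_integral_mono)
    show "set_integrable lborel {r..t0} (\<lambda>s. (t0 - s) powr (b - 1) * D s)"
      using r_pos r_less by (auto intro!: set_integrable_subset[OF D_int])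
    show "set_integrable lborel {r..t0} (\<lambda>s. (t0 - s) powr (b - 1) * D r)"
      using kernel_set_integrable[OF b(1)] by simp
    show "(t0 - s) powr (b - 1) * D s \<le> (t0 - s) powr (b - 1) * D r" if "s \<in> {r..t0}" for s
      using that r by (intro mult_left_mono max) auto
  qed
  also have "\<dots> = D r * ((t0 - r) powr b / b)"
    using kernel_set_integral[OF b(1) r(2)] by simp
  finally have "(LINT s:{0..t0}|lborel. (t0 - s) powr (b - 1) * D s) \<le>
      \<rho> * (LINT s:{0..r}|lborel. (r - s) powr (b - 1) * D s) + D r * ((t0 - r) powr b / b)"
    by simp
  then have "c * (LINT s:{0..t0}|lborel. (t0 - s) powr (b - 1) * D s) \<le>
      c * (\<rho> * (LINT s:{0..r}|lborel. (r - s) powr (b - 1) * D s) + D r * ((t0 - r) powr b / b))"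
    using c by (rule mult_left_mono)
  also have "\<dots> = \<rho> * (c * (LINT s:{0..r}|lborel. (r - s) powr (b - 1) * D s))
      + D r * (c * ((t0 - r) powr b / b))"
    by (simp add: algebra_simps)
  \<comment> \<open>The equation at r converts the old memory into g r - D r. The gain \<rho> D r,
    at least D r / 2, outweighs the contribution of [r, t0]; so the memory at t0 is less than \<rho>
    g r, hence less than g t0, and D t0 cannot be 0.\<close>
  also have "c * (LINT s:{0..r}|lborel. (r - s) powr (b - 1) * D s) = g r - D r"
    using eq[of r] r_pos by simp
  also have "\<rho> * (g r - D r) = \<rho> * g r - \<rho> * D r" by (rule right_diff_distrib)
  also have "D r * (c * ((t0 - r) powr b / b)) < D r * (1 / 2)"
    using Dr r by (intro mult_strict_left_mono d_small) auto
  also have "D r * (1 / 2) \<le> \<rho> * D r" using \<rho> Dr by simp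
  finally have "c * (LINT s:{0..t0}|lborel. (t0 - s) powr (b - 1) * D s) < \<rho> * g r" by simp
  then have "g t0 < \<rho> * g r" using eq[of t0] t0 by simp
  moreover have "\<rho> * g r \<le> g t0" unfolding \<rho>_def using r_pos r_less by (intro mono) auto
  ultimately show False by simp
qed

text \<open>S is the Mittag-Leffler function E_b(-c t^b). Positivity is the case of constant forcing
  1. For monotonicity, S - S(. + h) solves the same equation, its forcing being the memory that S(.
  + h) has of [0, h]; log-convexity gives this forcing the ratio property demanded by
  \<open>volterra_positive\<close>.\<close>

lemma volterra_relaxation:
  fixes b c :: real
  assumes b: "0 < b" "b \<le> 1" and c: "0 \<le> c"
  obtains S where "continuous_on {0..} S" "\<And>t. 0 \<le> t \<Longrightarrow> S t = 1 - c * frac_integral b S t"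
    "\<And>t. 0 \<le> t \<Longrightarrow> 0 < S t" "\<And>t t'. 0 \<le> t \<Longrightarrow> t \<le> t' \<Longrightarrow> S t' \<le> S t"
proof -
  obtain S where S: "continuous_on {0..} S" "\<And>t. 0 \<le> t \<Longrightarrow> S t = 1 + (- c) * frac_integral b S t"
    using volterra_linear_exists[OF b(1), of "\<lambda>_. 1" "- c"] by auto
  define k where "k = c / Gamma b"
  have k: "0 \<le> k" using c Gamma_real_pos[OF b(1)] by (simp add: k_def)
  have S_eq: "S t = 1 - k * (LINT s:{0..t}|lborel. (t - s) powr (b - 1) * S s)" if "0 \<le> t" for t
    using S(2)[OF that] by (simp add: frac_integral_def k_def)
  have S0: "S 0 = 1" using S(2)[of 0] by simp
  have ratio: "(t' / t) powr (b - 1) \<le> 1" if "0 < t" "t \<le> t'" for t t' :: real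
    using that b powr_mono2'[of "b - 1" 1 "t' / t"] by simp
  have S_pos: "0 < S t" if "0 \<le> t" for t
    using volterra_positive[OF b k S(1) _ S_eq _ that] S0 ratio by simp
  have S_int: "set_integrable lborel {0..r} (\<lambda>s. (r - s) powr (b - 1) * S s)" for r
    using kernel_integrable_continuous[OF b(1) S(1)] unfolding kernel_integrable_def .
  have S_mono: "S (t + h) \<le> S t" if h: "0 \<le> h" and "0 \<le> t" for t h
  proof -
    define g where "g r = k * (LINT s:{0..h}|lborel. (r + h - s) powr (b - 1) * S s)" for r
    have sub_int: "set_integrable lborel {0..h} (\<lambda>s. (r + h - s) powr (b - 1) * S s)" if "0 \<le> r" for r
      using that by (intro set_integrable_subset[OF S_int]) auto
    have shift_cont: "continuous_on {0..} (\<lambda>s. S (s + h))"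
      using h by (intro continuous_on_compose2[OF S(1)] continuous_intros) auto
    have D_eq: "S r - S (r + h) = g r - k * (LINT s:{0..r}|lborel. (r - s) powr (b - 1) * (S s - S (s + h)))"
      if r: "0 \<le> r" for r
    proof -
      have "(LINT s:{0..r + h}|lborel. (r + h - s) powr (b - 1) * S s) =
          (LINT s:{0..h}|lborel. (r + h - s) powr (b - 1) * S s) +
          (LINT s:{h..r + h}|lborel. (r + h - s) powr (b - 1) * S s)"
        using r h S_int by (intro set_integral_Icc_split) auto
      also have "(LINT s:{h..r + h}|lborel. (r + h - s) powr (b - 1) * S s) =
          (LINT s:{0..r}|lborel. (r - s) powr (b - 1) * S (s + h))"
        using set_integral_lborel_shift[of 0 r "\<lambda>s. (r + h - s) powr (b - 1) * S s" h] by simp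
      finally have "k * (LINT s:{0..r + h}|lborel. (r + h - s) powr (b - 1) * S s) =
          g r + k * (LINT s:{0..r}|lborel. (r - s) powr (b - 1) * S (s + h))"
        by (simp add: g_def distrib_left)
      then have e1: "S (r + h) = 1 - (g r + k * (LINT s:{0..r}|lborel. (r - s) powr (b - 1) * S (s + h)))"
        using S_eq[of "r + h"] r h by simp
      have "(LINT s:{0..r}|lborel. (r - s) powr (b - 1) * (S s - S (s + h))) =
          (LINT s:{0..r}|lborel. (r - s) powr (b - 1) * S s) -
          (LINT s:{0..r}|lborel. (r - s) powr (b - 1) * S (s + h))"
        using S_int[of r] kernel_integrable_continuous[OF b(1) shift_cont, of r]
        unfolding kernel_integrable_def by (simp add: right_diff_distrib set_integral_diff)
      then show ?thesis
        unfolding e1 S_eq[OF r] by (simp add: right_diff_distrib)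
    qed
    have g_mono: "(r' / r) powr (b - 1) * g r \<le> g r'" if r: "0 < r" "r \<le> r'" for r r'
    proof -
      have "(r' / r) powr (b - 1) * (LINT s:{0..h}|lborel. (r + h - s) powr (b - 1) * S s) =
          (LINT s:{0..h}|lborel. (r' / r) powr (b - 1) * ((r + h - s) powr (b - 1) * S s))"
        by simp
      also have "\<dots> \<le> (LINT s:{0..h}|lborel. (r' + h - s) powr (b - 1) * S s)"
      proof (rule set_integral_mono)
        show "set_integrable lborel {0..h} (\<lambda>s. (r' / r) powr (b - 1) * ((r + h - s) powr (b - 1) * S s))"
          "set_integrable lborel {0..h} (\<lambda>s. (r' + h - s) powr (b - 1) * S s)"
          using sub_int[of r] sub_int[of r'] r by auto
        fix s assume s: "s \<in> {0..h}"
        \<comment> \<open>The distance r + h - s consists of r, scaled exactly by r' / r, and of h -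
          s, nonnegative and kept fixed; so the total grows by a factor of at most r' / r.\<close>
        have "r' + h - s \<le> (r' / r) * (r + h - s)"
        proof -
          have "h - s \<le> (r' / r) * (h - s)" using r s mult_right_mono[of 1 "r' / r" "h - s"] by simp
          moreover have "(r' / r) * (r + h - s) = r' + (r' / r) * (h - s)"
            using r by (simp add: field_simps)
          ultimately show ?thesis by simp
        qed
        then have "((r' / r) * (r + h - s)) powr (b - 1) \<le> (r' + h - s) powr (b - 1)"
          using r s b by (intro powr_mono2') auto
        then have "(r' / r) powr (b - 1) * (r + h - s) powr (b - 1) \<le> (r' + h - s) powr (b - 1)"
          by (simp only: powr_mult)
        then show "(r' / r) powr (b - 1) * ((r + h - s) powr (b - 1) * S s) \<le> (r' + h - s) powr (b - 1) * S s"
          using S_pos[of s] s unfolding mult.assoc[symmetric] by (intro mult_right_mono) auto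
      qed
      finally have "k * ((r' / r) powr (b - 1) * (LINT s:{0..h}|lborel. (r + h - s) powr (b - 1) * S s))
          \<le> g r'"
        unfolding g_def using k by (rule mult_left_mono)
      then show ?thesis unfolding g_def by (simp add: mult.left_commute)
    qed
    \<comment> \<open>\<open>S - S (\<cdot> + h)\<close> may vanish at \<open>0\<close>; adding \<open>e S\<close> makes it positive there.\<close>
    have "0 < S t - S (t + h) + e * S t" if e: "0 < e" for e
    proof (rule volterra_positive[OF b k _ _ _ _ \<open>0 \<le> t\<close>,
          where D = "\<lambda>t. S t - S (t + h) + e * S t" and g = "\<lambda>t. g t + e"])
      show "continuous_on {0..} (\<lambda>t. S t - S (t + h) + e * S t)"
        by (intro continuous_intros S(1) shift_cont)
      have "0 \<le> g 0"
        unfolding g_def set_lebesgue_integral_def using k S_pos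
        by (intro mult_nonneg_nonneg integral_nonneg_AE AE_I2) (auto simp: indicator_def less_imp_le)
      moreover have "S h = 1 - g 0" using S_eq[OF h] by (simp add: g_def)
      ultimately show "0 < S 0 - S (0 + h) + e * S 0" using e S0 by simp
      show "S r - S (r + h) + e * S r = g r + e -
          k * (LINT s:{0..r}|lborel. (r - s) powr (b - 1) * (S s - S (s + h) + e * S s))" if "0 \<le> r" for r
      proof -
        have "set_integrable lborel {0..r} (\<lambda>s. (r - s) powr (b - 1) * (S s - S (s + h)))"
          using kernel_integrable_continuous[OF b(1), of "\<lambda>s. S s - S (s + h)" r] S(1) shift_cont
          unfolding kernel_integrable_def by (simp add: continuous_on_diff)
        then have "(LINT s:{0..r}|lborel. (r - s) powr (b - 1) * (S s - S (s + h)) + e * ((r - s) powr (b - 1) * S s)) =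
            (LINT s:{0..r}|lborel. (r - s) powr (b - 1) * (S s - S (s + h)))
            + e * (LINT s:{0..r}|lborel. (r - s) powr (b - 1) * S s)"
          using S_int[of r] by (subst set_integral_add(2)) auto
        then have "(LINT s:{0..r}|lborel. (r - s) powr (b - 1) * (S s - S (s + h) + e * S s)) =
            (LINT s:{0..r}|lborel. (r - s) powr (b - 1) * (S s - S (s + h)))
            + e * (LINT s:{0..r}|lborel. (r - s) powr (b - 1) * S s)"
          by (simp add: distrib_left mult.left_commute)
        moreover have "e * S r = e - k * (e * (LINT s:{0..r}|lborel. (r - s) powr (b - 1) * S s))"
          unfolding S_eq[OF that] by (simp add: algebra_simps)
        ultimately show ?thesis
          using D_eq[OF that] by (simp add: distrib_left)
      qed
      show "(t' / t) powr (b - 1) * (g t + e) \<le> g t' + e" if "0 < t" "t \<le> t'" for t t'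
        unfolding distrib_left using e
        by (intro add_mono g_mono[OF that] mult_left_le_one_le ratio[OF that]) auto
    qed
    \<comment> \<open>Division by S t > 0 leaves e alone on the right, so that e may tend to
      0.\<close>
    then have "S (t + h) - S t \<le> 0 + e * S t" if "0 < e" for e using that by (simp add: less_imp_le algebra_simps)
    then have "(S (t + h) - S t) / S t \<le> 0 + e" if "0 < e" for e
      using that S_pos[OF \<open>0 \<le> t\<close>] by (simp add: divide_le_eq)
    then have "(S (t + h) - S t) / S t \<le> 0" by (rule field_le_epsilon)
    then show ?thesis using S_pos[OF \<open>0 \<le> t\<close>] by (simp add: divide_le_0_iff)
  qed
  show ?thesis
  proof (rule that[OF S(1)])
    show "S t = 1 - c * frac_integral b S t" if "0 \<le> t" for t using S(2)[OF that] by simp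
    show "S t' \<le> S t" if "0 \<le> t" "t \<le> t'" for t t'
      using S_mono[of "t' - t" t] that by simp
  qed (rule S_pos)
qed

section \<open>Convolution with the relaxation function and the comparison principle\<close>

lemma set_borel_measurable_bounded_integrable:
  fixes f :: "real \<Rightarrow> real"
  assumes "set_borel_measurable lborel {a..b} f" "\<And>s. a \<le> s \<Longrightarrow> s \<le> b \<Longrightarrow> \<bar>f s\<bar> \<le> B"
  shows "set_integrable lborel {a..b} f"
proof (rule set_integrable_bound[where f = "\<lambda>_. B"])
  show "set_integrable lborel {a..b} (\<lambda>_. B)"
    by (intro borel_integrable_atLeastAtMost' continuous_intros)
  show "AE x in lborel. x \<in> {a..b} \<longrightarrow> norm (f x) \<le> norm B"
    using assms(2) by (intro AE_I2) force
qed (rule assms(1))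

text \<open>Associativity of convolution: S, the power kernel and \<open>\<phi>\<close> are
  integrated over the triangle u \<le> s in [0, t], and Fubini exchanges the order.\<close>

lemma frac_integral_convolution:
  fixes b t B :: real and S \<phi> :: "real \<Rightarrow> real"
  assumes b: "0 < b" and S: "continuous_on {0..} S"
    and \<phi>: "set_borel_measurable lborel {0..t} \<phi>" "\<And>s. 0 \<le> s \<Longrightarrow> s \<le> t \<Longrightarrow> \<bar>\<phi> s\<bar> \<le> B"
  shows "(LINT s:{0..t}|lborel. S (t - s) * frac_integral b \<phi> s) =
    (LINT u:{0..t}|lborel. frac_integral b S (t - u) * \<phi> u)"
proof -
  obtain M where M: "0 \<le> M" "\<And>s. 0 \<le> s \<Longrightarrow> s \<le> t \<Longrightarrow> \<bar>S s\<bar> \<le> M"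
    using continuous_on_halfline_bounded[OF S] by blast
  have B: "0 \<le> B" if "0 \<le> t" using \<phi>(2)[of 0] that by simp
  \<comment> \<open>Cutting off to [0, t] gives functions that are Borel on the whole line, so the
    integrand is jointly measurable. \<open>F_eq\<close> and \<open>F_eq'\<close> then exhibit it in
    the form suited to each order of integration.\<close>
  define S' where "S' x = indicator {0..t} x * S x" for x
  define \<phi>' where "\<phi>' x = indicator {0..t} x * \<phi> x" for x
  have [measurable]: "S' \<in> borel_measurable borel" "\<phi>' \<in> borel_measurable borel"
    using continuous_on_set_borel_measurable[OF S, of 0 t] \<phi>(1)
    unfolding S'_def[abs_def] \<phi>'_def[abs_def] set_borel_measurable_def by simp_all
  define F where "F s u = indicator {p. snd p \<le> fst p} (s, u) * (S' (t - s) * (s - u) powr (b - 1) * \<phi>' u)"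
    for s u :: real
  have F_meas: "(\<lambda>(s, u). F s u) \<in> borel_measurable (lborel \<Otimes>\<^sub>M lborel)"
    unfolding F_def case_prod_unfold by measurable
  have F_eq: "F s u = indicator {0..t} s *\<^sub>R (S (t - s) * (indicator {0..s} u *\<^sub>R ((s - u) powr (b - 1) * \<phi> u)))"
    for s u
    by (auto simp: F_def S'_def \<phi>'_def indicator_def)
  have F_eq': "F s u = indicator {0..t} u *\<^sub>R (\<phi> u * (indicator {u..t} s *\<^sub>R ((s - u) powr (b - 1) * S (t - s))))"
    for s u
    by (auto simp: F_def S'_def \<phi>'_def indicator_def)
  have \<phi>_int: "set_integrable lborel {0..s} (\<lambda>u. (s - u) powr (b - 1) * \<phi> u)" if "s \<le> t" for s
  proof (rule kernel_mult_set_integrable[OF b, where B = B])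
    show "set_borel_measurable lborel {0..s} \<phi>"
      using that by (intro set_borel_measurable_subset[OF \<phi>(1)]) auto
  qed (use \<phi>(2) that in auto)
  have F_int: "integrable lborel (F s)" for s
  proof (cases "s \<in> {0..t}")
    case True
    then show ?thesis
      using \<phi>_int[of s] unfolding F_eq set_integrable_def by (auto intro: integrable_mult_right)
  qed (simp add: F_eq[abs_def])
  have F_norm: "(LINT u|lborel. \<bar>F s u\<bar>) \<le> indicator {0..t} s *\<^sub>R (M * B * (t powr b / b))" for s
  proof (cases "s \<in> {0..t}")
    case True
    have "(LINT u|lborel. \<bar>F s u\<bar>) \<le> (LINT u|lborel. M * B * (indicator {0..s} u *\<^sub>R (s - u) powr (b - 1)))"
    proof (rule integral_mono)
      show "integrable lborel (\<lambda>u. \<bar>F s u\<bar>)" using F_int by (rule integrable_abs)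
      show "integrable lborel (\<lambda>u. M * B * (indicator {0..s} u *\<^sub>R (s - u) powr (b - 1)))"
        using kernel_set_integrable[OF b, of 0 s] unfolding set_integrable_def
        by (rule integrable_mult_right)
      fix u
      have "\<bar>S (t - s)\<bar> * \<bar>\<phi> u\<bar> \<le> M * B" if "0 \<le> u" "u \<le> s"
        using True that M \<phi>(2)[of u] by (intro mult_mono) auto
      then have "\<bar>S (t - s)\<bar> * \<bar>\<phi> u\<bar> * (s - u) powr (b - 1) \<le> M * B * (s - u) powr (b - 1)"
        if "0 \<le> u" "u \<le> s"
        using that by (intro mult_right_mono) auto
      then show "\<bar>F s u\<bar> \<le> M * B * (indicator {0..s} u *\<^sub>R (s - u) powr (b - 1))"
        unfolding F_eq using True by (auto simp: indicator_def abs_mult mult_ac)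
    qed
    also have "\<dots> = M * B * (LINT u:{0..s}|lborel. (s - u) powr (b - 1))"
      unfolding set_lebesgue_integral_def by (rule integral_mult_right_zero)
    also have "(LINT u:{0..s}|lborel. (s - u) powr (b - 1)) = s powr b / b"
      using True kernel_set_integral[OF b, of 0 s] by simp
    \<comment> \<open>Replacing s by t makes the bound constant on [0, t], hence integrable
      there.\<close>
    also have "M * B * (s powr b / b) \<le> M * B * (t powr b / b)"
      using True b M(1) B by (intro mult_left_mono divide_right_mono powr_mono2) auto
    finally show ?thesis using True by simp
  qed (simp add: F_eq)
  have F_pair: "integrable (lborel \<Otimes>\<^sub>M lborel) (\<lambda>(s, u). F s u)"
  proof (rule lborel_pair.Fubini_integrable[OF F_meas])
    have "integrable lborel (\<lambda>s. LINT u|lborel. \<bar>F s u\<bar>)"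
    proof (rule Bochner_Integration.integrable_bound)
      show "integrable lborel (\<lambda>s. indicator {0..t} s *\<^sub>R (M * B * (t powr b / b)))"
        using borel_integrable_atLeastAtMost'[OF continuous_on_const, of 0 t "M * B * (t powr b / b)"]
        unfolding set_integrable_def .
      show "(\<lambda>s. LINT u|lborel. \<bar>F s u\<bar>) \<in> borel_measurable lborel"
        using F_meas by measurable
      show "AE s in lborel. norm (LINT u|lborel. \<bar>F s u\<bar>)
          \<le> norm (indicator {0..t} s *\<^sub>R (M * B * (t powr b / b)))"
      proof (rule AE_I2)
        fix s
        have "norm (LINT u|lborel. \<bar>F s u\<bar>) = (LINT u|lborel. \<bar>F s u\<bar>)"
          by (simp add: integral_nonneg_AE)
        also have "\<dots> \<le> norm (indicator {0..t} s *\<^sub>R (M * B * (t powr b / b)))"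
          using F_norm[of s] unfolding real_norm_def by (rule order_trans) (rule abs_ge_self)
        finally show "norm (LINT u|lborel. \<bar>F s u\<bar>)
          \<le> norm (indicator {0..t} s *\<^sub>R (M * B * (t powr b / b)))" .
      qed
    qed
    then show "integrable lborel (\<lambda>s. LINT u|lborel. norm (case (s, u) of (s, u) \<Rightarrow> F s u))"
      by simp
  qed (use F_int in simp)
  have "(LINT s|lborel. LINT u|lborel. F s u) = (LINT u|lborel. LINT s|lborel. F s u)"
    using lborel_pair.Fubini_integral[OF F_pair] by simp
  moreover have "(LINT u|lborel. F s u) =
      Gamma b * (indicator {0..t} s *\<^sub>R (S (t - s) * frac_integral b \<phi> s))" for s
    using Gamma_real_pos[OF b]
    unfolding F_eq frac_integral_def set_lebesgue_integral_def by simp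
  moreover have "(LINT s|lborel. F s u) =
      Gamma b * (indicator {0..t} u *\<^sub>R (frac_integral b S (t - u) * \<phi> u))" for u
  proof -
    have "(LINT s:{u..t}|lborel. (s - u) powr (b - 1) * S (t - s)) =
        (LINT v:{0..t - u}|lborel. (t - u - v) powr (b - 1) * S v)"
      by (subst set_integral_lborel_reflect) (simp add: algebra_simps)
    also have "\<dots> = Gamma b * frac_integral b S (t - u)"
      using Gamma_real_pos[OF b] unfolding frac_integral_def by simp
    finally show ?thesis
      unfolding F_eq' set_lebesgue_integral_def by simp
  qed
  ultimately have "Gamma b * (LINT s:{0..t}|lborel. S (t - s) * frac_integral b \<phi> s) =
      Gamma b * (LINT u:{0..t}|lborel. frac_integral b S (t - u) * \<phi> u)"
    unfolding set_lebesgue_integral_def by simp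
  then show ?thesis using Gamma_real_pos[OF b] by simp
qed

text \<open>The primitive of W, multiplied by c, equals G. Since S is nonincreasing and at most 1
  and \<open>\<kappa>\<close> is nonnegative, G is nondecreasing; a continuous W with nondecreasing
  primitive is nonnegative.\<close>

lemma volterra_nonneg:
  fixes b c t T B :: real and W \<kappa> :: "real \<Rightarrow> real"
  assumes b: "0 < b" "b \<le> 1" and c: "0 < c" and W: "continuous_on {0..} W"
    and \<kappa>: "set_borel_measurable lborel {0..T} \<kappa>" "\<And>s. 0 \<le> s \<Longrightarrow> s \<le> T \<Longrightarrow> 0 \<le> \<kappa> s"
      "\<And>s. 0 \<le> s \<Longrightarrow> s \<le> T \<Longrightarrow> \<kappa> s \<le> B"
    and eq: "\<And>s. 0 \<le> s \<Longrightarrow> s \<le> T \<Longrightarrow> W s = frac_integral b \<kappa> s - c * frac_integral b W s"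
    and t: "0 \<le> t" "t \<le> T"
  shows "0 \<le> W t"
proof -
  obtain S where S: "continuous_on {0..} S" "\<And>t. 0 \<le> t \<Longrightarrow> S t = 1 - c * frac_integral b S t"
      "\<And>t. 0 \<le> t \<Longrightarrow> 0 < S t" "\<And>t t'. 0 \<le> t \<Longrightarrow> t \<le> t' \<Longrightarrow> S t' \<le> S t"
    using volterra_relaxation[OF b, of c] c by (metis less_imp_le)
  have S_le_1: "S r \<le> 1" if "0 \<le> r" for r
    using S(4)[of 0 r] S(2)[of 0] that by simp
  define G where "G r = (LINT u:{0..r}|lborel. (1 - S (r - u)) * \<kappa> u)" for r
  have \<kappa>_meas: "set_borel_measurable lborel {0..r} \<kappa>" if "r \<le> T" for r
    using that by (intro set_borel_measurable_subset[OF \<kappa>(1)]) auto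
  have \<kappa>_abs: "\<bar>\<kappa> s\<bar> \<le> B" if "0 \<le> s" "s \<le> T" for s
    using \<kappa>(2,3)[of s] that by simp
  have W_int: "set_integrable lborel {a..r} W" if "0 \<le> a" for a r
    using that by (intro borel_integrable_atLeastAtMost' continuous_on_subset[OF W]) auto
  have S\<phi>_int: "set_integrable lborel {0..r} (\<lambda>u. S (r' - u) * \<phi> u)"
    if "set_borel_measurable lborel {0..r} \<phi>" "\<And>s. 0 \<le> s \<Longrightarrow> s \<le> r \<Longrightarrow> \<bar>\<phi> s\<bar> \<le> M" "r \<le> r'"
    for r r' M and \<phi> :: "real \<Rightarrow> real"
  proof (rule set_borel_measurable_bounded_integrable[where B = M])
    have "continuous_on {0..r} (\<lambda>u. S (r' - u))"
      using \<open>r \<le> r'\<close> by (intro continuous_on_compose2[OF S(1)] continuous_intros) auto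
    then have "(\<lambda>u. indicator {0..r} u *\<^sub>R S (r' - u)) \<in> borel_measurable borel"
      by (intro borel_measurable_continuous_on_indicator) auto
    then have "(\<lambda>u. (indicator {0..r} u *\<^sub>R S (r' - u)) * (indicator {0..r} u *\<^sub>R \<phi> u)) \<in> borel_measurable lborel"
      using that(1) unfolding set_borel_measurable_def by (intro borel_measurable_times) auto
    moreover have "(indicator {0..r} u *\<^sub>R S (r' - u)) * (indicator {0..r} u *\<^sub>R \<phi> u) =
        indicator {0..r} u *\<^sub>R (S (r' - u) * \<phi> u)" for u
      by (auto simp: indicator_def)
    ultimately show "set_borel_measurable lborel {0..r} (\<lambda>u. S (r' - u) * \<phi> u)"
      unfolding set_borel_measurable_def by (simp only:)
    show "\<bar>S (r' - s) * \<phi> s\<bar> \<le> M" if "0 \<le> s" "s \<le> r" for s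
    proof -
      have "\<bar>S (r' - s)\<bar> * \<bar>\<phi> s\<bar> \<le> 1 * \<bar>\<phi> s\<bar>"
        using S(3)[of "r' - s"] S_le_1[of "r' - s"] that \<open>r \<le> r'\<close> by (intro mult_right_mono) auto
      then show ?thesis using \<open>\<And>s. 0 \<le> s \<Longrightarrow> s \<le> r \<Longrightarrow> \<bar>\<phi> s\<bar> \<le> M\<close>[OF that] by (simp add: abs_mult)
    qed
  qed
  have \<kappa>_int: "set_integrable lborel {0..r} \<kappa>" if "r \<le> T" for r
    using \<kappa>_meas[OF that] \<kappa>_abs that
    by (intro set_borel_measurable_bounded_integrable[where B = B]) auto
  have \<kappa>_S_int: "set_integrable lborel {0..r} (\<lambda>u. (1 - S (r' - u)) * \<kappa> u)" if "r \<le> T" "r \<le> r'" for r r'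
    using \<kappa>_int[OF that(1)] S\<phi>_int[OF \<kappa>_meas[OF that(1)] \<kappa>_abs that(2)] that(1)
    by (simp add: left_diff_distrib set_integral_diff)
  \<comment> \<open>Convolve \<open>W = I\<^sup>b (\<kappa> - c W)\<close> with \<open>S\<close> and use \<open>c I\<^sup>b S = 1 - S\<close>.\<close>
  have W_G: "c * (LINT u:{0..r}|lborel. W u) = G r" if r: "0 \<le> r" "r \<le> T" for r
  proof -
    obtain M where M: "\<And>s. 0 \<le> s \<Longrightarrow> s \<le> r \<Longrightarrow> \<bar>W s\<bar> \<le> M"
      using continuous_on_halfline_bounded[OF W] by blast
    define \<phi> where "\<phi> s = \<kappa> s - c * W s" for s
    have \<phi>_meas: "set_borel_measurable lborel {0..r} \<phi>"
      using \<kappa>_meas[OF r(2)] continuous_on_set_borel_measurable[OF W order_refl, of r]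
      unfolding set_borel_measurable_def \<phi>_def by (simp add: right_diff_distrib mult.left_commute[of _ c])
    have \<phi>_bdd: "\<bar>\<phi> s\<bar> \<le> B + c * M" if "0 \<le> s" "s \<le> r" for s
    proof -
      have "\<bar>\<phi> s\<bar> \<le> \<bar>\<kappa> s\<bar> + c * \<bar>W s\<bar>"
        unfolding \<phi>_def using c by (simp add: abs_mult order_trans[OF abs_triangle_ineq4])
      also have "\<dots> \<le> B + c * M"
        using \<kappa>_abs[of s] M[of s] that r c by (intro add_mono mult_left_mono) auto
      finally show ?thesis .
    qed
    have W_frac: "W s = frac_integral b \<phi> s" if "0 \<le> s" "s \<le> r" for s
    proof -
      have "kernel_integrable b \<kappa> s"
        using \<kappa>_meas[of s] \<kappa>_abs that r b by (intro kernel_integrable_bounded[where B = B]) auto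
      then show ?thesis
        using eq[of s] that r b unfolding \<phi>_def
        by (simp add: frac_integral_diff frac_integral_mult kernel_integrable_mult kernel_integrable_continuous W)
    qed
    have "c * (LINT s:{0..r}|lborel. S (r - s) * W s) = c * (LINT s:{0..r}|lborel. S (r - s) * frac_integral b \<phi> s)"
      using W_frac by (intro arg_cong[of _ _ "\<lambda>x. c * x"] set_lebesgue_integral_cong) auto
    also have "\<dots> = c * (LINT u:{0..r}|lborel. frac_integral b S (r - u) * \<phi> u)"
      using frac_integral_convolution[OF b(1) S(1) \<phi>_meas \<phi>_bdd] by simp
    also have "\<dots> = (LINT u:{0..r}|lborel. (c * frac_integral b S (r - u)) * \<phi> u)"
      by (simp only: mult.assoc set_integral_mult_right)
    also have "\<dots> = (LINT u:{0..r}|lborel. (1 - S (r - u)) * \<phi> u)"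
      using S(2) by (intro set_lebesgue_integral_cong) auto
    \<comment> \<open>The last summand is the left end of this chain, so it cancels and leaves c
      times the integral of W equal to G.\<close>
    also have "\<dots> = (LINT u:{0..r}|lborel. ((1 - S (r - u)) * \<kappa> u - c * W u) + c * (S (r - u) * W u))"
      by (intro set_lebesgue_integral_cong) (auto simp: \<phi>_def algebra_simps)
    also have "\<dots> = G r - c * (LINT u:{0..r}|lborel. W u) + c * (LINT u:{0..r}|lborel. S (r - u) * W u)"
      unfolding G_def
      using \<kappa>_S_int[of r r] W_int[of 0 r] r
        S\<phi>_int[OF continuous_on_set_borel_measurable[OF W order_refl] M order_refl]
      by (simp add: set_integral_add set_integral_diff)
    finally show ?thesis by simp
  qed
  \<comment> \<open>Two effects: the weight 1 - S(r - u) grows with r, and the longer range adds a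
    nonnegative integrand.\<close>
  have G_mono: "G r \<le> G r'" if r: "0 \<le> r" "r \<le> r'" "r' \<le> T" for r r'
  proof -
    have "G r \<le> (LINT u:{0..r}|lborel. (1 - S (r' - u)) * \<kappa> u)"
      unfolding G_def
    proof (rule set_integral_mono)
      fix u assume u: "u \<in> {0..r}"
      then show "(1 - S (r - u)) * \<kappa> u \<le> (1 - S (r' - u)) * \<kappa> u"
        using r S(4)[of "r - u" "r' - u"] \<kappa>(2)[of u] by (intro mult_right_mono) auto
    qed (use r \<kappa>_S_int in auto)
    also have "\<dots> \<le> G r'"
      unfolding G_def set_lebesgue_integral_def
    proof (rule integral_mono)
      show "integrable lborel (\<lambda>u. indicator {0..r} u *\<^sub>R ((1 - S (r' - u)) * \<kappa> u))"
        "integrable lborel (\<lambda>u. indicator {0..r'} u *\<^sub>R ((1 - S (r' - u)) * \<kappa> u))"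
        using \<kappa>_S_int[of r r'] \<kappa>_S_int[of r' r'] r unfolding set_integrable_def by auto
      fix u
      have "0 \<le> (1 - S (r' - u)) * \<kappa> u" if "0 \<le> u" "u \<le> r'"
        using that r S_le_1[of "r' - u"] \<kappa>(2)[of u] by auto
      then show "indicator {0..r} u *\<^sub>R ((1 - S (r' - u)) * \<kappa> u)
          \<le> indicator {0..r'} u *\<^sub>R ((1 - S (r' - u)) * \<kappa> u)"
        using r by (auto simp: indicator_def)
    qed
    finally show ?thesis .
  qed
  show ?thesis
  proof (rule ccontr)
    assume "\<not> 0 \<le> W t"
    then have neg: "W t < 0" by simp
    have "W 0 = 0" using eq[of 0] t by simp
    then have "0 < t" using neg t by (cases "t = 0") auto
    have "\<forall>x\<in>{0..}. \<exists>d>0. \<forall>s\<in>{0..}. dist s x < d \<longrightarrow> dist (W s) (W x) < - W t / 2"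
      using W neg unfolding continuous_on_iff by simp
    from bspec[OF this, of t] obtain d where d: "0 < d" "\<And>s. 0 \<le> s \<Longrightarrow> \<bar>s - t\<bar> < d \<Longrightarrow> \<bar>W s - W t\<bar> < - W t / 2"
      using t by (auto simp: dist_real_def)
    \<comment> \<open>A left neighbourhood of t is taken because the equation is known only up to T.
      There W stays below W t / 2 < 0, so its primitive drops strictly.\<close>
    define r where "r = max 0 (t - d / 2)"
    have r: "0 \<le> r" "r < t" "\<And>s. r \<le> s \<Longrightarrow> s \<le> t \<Longrightarrow> \<bar>s - t\<bar> < d"
      using d(1) \<open>0 < t\<close> by (auto simp: r_def)
    have "(LINT u:{r..t}|lborel. W u) \<le> (LINT u:{r..t}|lborel. W t / 2)"
    proof (rule set_integral_mono)
      show "set_integrable lborel {r..t} (\<lambda>u. W t / 2)"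
        by (intro borel_integrable_atLeastAtMost' continuous_intros)
      show "W u \<le> W t / 2" if "u \<in> {r..t}" for u
        using d(2)[of u] r(1) r(3)[of u] that by (simp add: abs_less_iff)
    qed (rule W_int[OF r(1)])
    also have "\<dots> = (t - r) * (W t / 2)"
      using r by (simp add: set_integral_const)
    also have "\<dots> < 0" using r neg by (simp add: mult_pos_neg)
    finally have "(LINT u:{r..t}|lborel. W u) < 0" .
    moreover have "(LINT u:{0..t}|lborel. W u) = (LINT u:{0..r}|lborel. W u) + (LINT u:{r..t}|lborel. W u)"
      using r W_int by (intro set_integral_Icc_split) auto
    ultimately have "c * (LINT u:{0..t}|lborel. W u) < c * (LINT u:{0..r}|lborel. W u)"
      using c by simp
    then have "G t < G r" using W_G[of t] W_G[of r] r t by simp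
    then show False using G_mono[of r t] r t by simp
  qed
qed

text \<open>Fractional integration commutes with a delay by T. This handles a forcing that changes
  its value at time T.\<close>

lemma frac_integral_shift:
  assumes "0 \<le> T"
  shows "frac_integral b (\<lambda>s. if s < T then 0 else \<phi> (s - T)) t = (if t < T then 0 else frac_integral b \<phi> (t - T))"
proof -
  let ?F = "\<lambda>s. (t - s) powr (b - 1) * (if s < T then 0 else \<phi> (s - T))"
  have "(LINT s:{0..t}|lborel. ?F s) = (LINT s:{T..t}|lborel. (t - s) powr (b - 1) * \<phi> (s - T))"
    unfolding set_lebesgue_integral_def using assms
    by (intro Bochner_Integration.integral_cong) (auto simp: indicator_def)
  also have "\<dots> = (LINT s:{0..t - T}|lborel. (t - T - s) powr (b - 1) * \<phi> s)"
    using set_integral_lborel_shift[of 0 "t - T" "\<lambda>s. (t - s) powr (b - 1) * \<phi> (s - T)" T]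
    by (simp add: algebra_simps)
  finally show ?thesis
    unfolding frac_integral_def by (simp add: set_lebesgue_integral_def)
qed

text \<open>Z is compared with the explicit solution for the forcing that equals M before T and m
  from T on. Keeping the two apart lets a crude bound on the past fade with S(t - T) - S(t); T = 0
  gives the uniform estimate.\<close>

lemma volterra_bound:
  fixes b c t T M m :: real and Z k S :: "real \<Rightarrow> real"
  assumes b: "0 < b" "b \<le> 1" and c: "0 < c"
    and S: "continuous_on {0..} S" "\<And>t. 0 \<le> t \<Longrightarrow> S t = 1 - c * frac_integral b S t"
    and Z: "continuous_on {0..} Z" and k: "set_borel_measurable lborel {0..t} k"
    and T: "0 \<le> T" "T \<le> t"
    and k_M: "\<And>s. 0 \<le> s \<Longrightarrow> s < T \<Longrightarrow> \<bar>k s\<bar> \<le> M" and k_m: "\<And>s. T \<le> s \<Longrightarrow> s \<le> t \<Longrightarrow> \<bar>k s\<bar> \<le> m"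
    and eq: "\<And>s. 0 \<le> s \<Longrightarrow> s \<le> t \<Longrightarrow> Z s = frac_integral b k s - c * frac_integral b Z s"
  shows "c * \<bar>Z t\<bar> \<le> M * (S (t - T) - S t) + m * (1 - S (t - T))"
proof -
  define bd where "bd s = (if s < T then M else m)" for s
  \<comment> \<open>\<open>U\<close> solves the equation with forcing \<open>bd\<close>, since \<open>(1 - S) / c\<close> solves it with forcing \<open>1\<close>.\<close>
  define U where "U s = (M * (1 - S s) - (M - m) * (1 - S (max 0 (s - T)))) / c" for s
  have bd: "\<bar>k s\<bar> \<le> bd s" if "0 \<le> s" "s \<le> t" for s
    using k_M k_m that by (simp add: bd_def)
  have bd_meas: "set_borel_measurable lborel {0..r} bd" for r
    unfolding bd_def[abs_def] set_borel_measurable_def by measurable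
  have bd_int: "kernel_integrable b bd r" for r
    using kernel_integrable_bounded[OF b(1) bd_meas, of r "max \<bar>M\<bar> \<bar>m\<bar>"] by (auto simp: bd_def)
  \<comment> \<open>Freezing the argument at 0 makes the delayed part vanish before T, as S 0 = 1;
    thus U is continuous although \<open>bd\<close> may jump.\<close>
  have U_cont: "continuous_on {0..} U"
    unfolding U_def using c
    by (intro continuous_intros S(1) continuous_on_compose2[OF S(1)]) auto
  have S0: "S 0 = 1" using S(2)[of 0] by simp
  have U_eq: "U s = frac_integral b bd s - c * frac_integral b U s" if s: "0 \<le> s" for s
  proof -
    define S2 where "S2 s = (if s < T then 0 else S (s - T))" for s
    have S2_meas: "set_borel_measurable lborel {0..s} S2"
    proof -
      have "continuous_on {T..s} (\<lambda>s. S (s - T))"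
        by (intro continuous_on_compose2[OF S(1)] continuous_intros) auto
      then have "(\<lambda>x. indicator {T..s} x *\<^sub>R S (x - T)) \<in> borel_measurable lborel"
        using borel_measurable_continuous_on_indicator[of "{T..s}" "\<lambda>x. S (x - T)"] by simp
      moreover have "indicator {0..s} x *\<^sub>R S2 x = indicator {T..s} x *\<^sub>R S (x - T)" for x
        using T by (auto simp: S2_def indicator_def)
      ultimately show ?thesis unfolding set_borel_measurable_def by simp
    qed
    obtain K where K: "0 \<le> K" "\<And>r. 0 \<le> r \<Longrightarrow> r \<le> s \<Longrightarrow> \<bar>S r\<bar> \<le> K"
      using continuous_on_halfline_bounded[OF S(1)] by blast
    have S2_int: "kernel_integrable b S2 s"
      using K T by (intro kernel_integrable_bounded[OF b(1) S2_meas, of K]) (auto simp: S2_def)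
    have S_int: "kernel_integrable b S s"
      using b(1) S(1) by (rule kernel_integrable_continuous)
    \<comment> \<open>The constants cancel on both sides of T, leaving S and its delayed copy
      \<open>S2\<close>, whose fractional integrals are known from the equation for S.\<close>
    have "bd r - c * U r = M * S r - (M - m) * S2 r" for r
    proof -
      have "c * U r = M * (1 - S r) - (M - m) * (1 - S (max 0 (r - T)))"
        unfolding U_def using c by simp
      then show ?thesis
        unfolding bd_def S2_def using S0 by (cases "r < T") (simp_all add: algebra_simps max_def)
    qed
    then have "frac_integral b bd s - c * frac_integral b U s = M * frac_integral b S s - (M - m) * frac_integral b S2 s"
      using frac_integral_diff[OF bd_int kernel_integrable_mult[OF kernel_integrable_continuous[OF b(1) U_cont]], of c s]
        frac_integral_diff[OF kernel_integrable_mult[OF S_int] kernel_integrable_mult[OF S2_int], of M "M - m"]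
      by (simp add: frac_integral_mult)
    also have "frac_integral b S2 s = (if s < T then 0 else frac_integral b S (s - T))"
      unfolding S2_def[abs_def] using T(1) by (rule frac_integral_shift)
    also have "M * frac_integral b S s - (M - m) * (if s < T then 0 else frac_integral b S (s - T)) = U s"
    proof -
      have "frac_integral b S r = (1 - S r) / c" if "0 \<le> r" for r
        using S(2)[OF that] c by (simp add: field_simps)
      moreover have "U s = M * ((1 - S s) / c) - (M - m) * ((1 - S (max 0 (s - T))) / c)"
        unfolding U_def by (simp only: diff_divide_distrib[of "M * (1 - S s)"] times_divide_eq_right)
      ultimately show ?thesis
        using s S0 by (auto simp: max_def)
    qed
    finally show ?thesis by simp
  qed
  have k_meas: "set_borel_measurable lborel {0..s} k" if "s \<le> t" for s
    using that by (intro set_borel_measurable_subset[OF k]) auto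
  have k_int: "kernel_integrable b k s" if "s \<le> t" for s
  proof (rule kernel_integrable_bounded[OF b(1) k_meas[OF that], where B = "max \<bar>M\<bar> \<bar>m\<bar>"])
    show "\<bar>k r\<bar> \<le> max \<bar>M\<bar> \<bar>m\<bar>" if "0 \<le> r" "r \<le> s" for r
      using bd[of r] that \<open>s \<le> t\<close> by (auto simp: bd_def split: if_splits)
  qed
  \<comment> \<open>For e = 1 and e = -1 the forcing \<open>bd - e * k\<close> is nonnegative, so
    the comparison principle bounds Z from both sides by U.\<close>
  have comp: "0 \<le> U t - e * Z t" if e: "\<bar>e\<bar> = 1" for e
  proof (rule volterra_nonneg[OF b c, where W = "\<lambda>t. U t - e * Z t" and \<kappa> = "\<lambda>s. bd s - e * k s"
        and B = "2 * max M m" and T = t])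
    show "continuous_on {0..} (\<lambda>t. U t - e * Z t)"
      by (intro continuous_intros U_cont Z)
    show "set_borel_measurable lborel {0..t} (\<lambda>s. bd s - e * k s)"
      using bd_meas[of t] k unfolding set_borel_measurable_def
      by (simp add: right_diff_distrib mult.left_commute[of _ e])
    have ek: "\<bar>e * k s\<bar> \<le> bd s" if "0 \<le> s" "s \<le> t" for s
      using bd[OF that] e by (simp add: abs_mult)
    show "0 \<le> bd s - e * k s" if "0 \<le> s" "s \<le> t" for s
      using ek[OF that] by (simp add: abs_le_iff)
    show "bd s - e * k s \<le> 2 * max M m" if "0 \<le> s" "s \<le> t" for s
    proof -
      have "bd s \<le> max M m" by (simp add: bd_def)
      then show ?thesis using ek[OF that] by linarith
    qed
    show "U s - e * Z s = frac_integral b (\<lambda>s. bd s - e * k s) s - c * frac_integral b (\<lambda>t. U t - e * Z t) s"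
      if s: "0 \<le> s" "s \<le> t" for s
    proof -
      have "frac_integral b (\<lambda>s. bd s - e * k s) s = frac_integral b bd s - e * frac_integral b k s"
        using bd_int k_int[OF s(2)] by (simp add: frac_integral_diff frac_integral_mult kernel_integrable_mult)
      moreover have "frac_integral b (\<lambda>t. U t - e * Z t) s = frac_integral b U s - e * frac_integral b Z s"
        using b(1) U_cont Z
        by (simp add: frac_integral_diff frac_integral_mult kernel_integrable_mult kernel_integrable_continuous)
      moreover have "e * Z s = e * frac_integral b k s - c * (e * frac_integral b Z s)"
        by (subst eq[OF s]) (simp add: right_diff_distrib mult.left_commute)
      ultimately show ?thesis
        using U_eq[OF s(1)] by (simp add: right_diff_distrib)
    qed
  qed (use T in auto)
  have "\<bar>Z t\<bar> \<le> U t" using comp[of 1] comp[of "-1"] by (simp add: abs_le_iff)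
  then have "c * \<bar>Z t\<bar> \<le> c * U t" using c by simp
  also have "\<dots> = M * (S (t - T) - S t) + m * (1 - S (t - T))"
  proof -
    have "c * U t = M * (1 - S t) - (M - m) * (1 - S (max 0 (t - T)))"
      unfolding U_def using c by simp
    then show ?thesis using T by (simp add: algebra_simps)
  qed
  finally show ?thesis .
qed

section \<open>Stability\<close>

text \<open>The hypotheses on (2) concern every solution, so they yield nothing until some Y is at
  hand. The integrated-by-parts form of the Young integral is continuous in t, which reduces
  existence to the Volterra equation.\<close>

lemma solution_linear_exists:
  assumes \<beta>: "0 < \<beta>" and \<alpha>: "1 < \<alpha>" and \<gamma>: "0 < \<gamma>"
    and \<xi>: "continuous_on {0..} \<xi>" and adm: "admissible \<gamma> \<tau> f \<theta>"
  obtains Y where "solution_linear \<alpha> \<beta> A \<xi> f \<theta> Y"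
proof -
  have \<theta>: "continuous_on {0..} \<theta>" "\<theta> 0 = 0" and f: "C1_halfline f"
    using adm holder_imp_continuous_on[OF \<gamma>] unfolding admissible_def by auto
  have f': "continuous_on {0..} (halfline_deriv f)"
    using f unfolding C1_halfline_def by auto
  have f_cont: "continuous_on {0..} f"
    using f unfolding C1_halfline_def by (intro DERIV_continuous_on) auto
  define J where "J t = frac_integral (\<alpha> - 1) (\<lambda>s. f s * \<theta> s) t - frac_integral \<alpha> (\<lambda>s. halfline_deriv f s * \<theta> s) t"
    for t
  have J_cont: "continuous_on {0..} J"
    unfolding J_def using \<alpha> by (intro continuous_intros continuous_on_frac_integral \<theta> f' f_cont) auto
  obtain Y where Y: "continuous_on {0..} Y" "\<And>t. 0 \<le> t \<Longrightarrow> Y t = (\<xi> t + J t) + A * frac_integral \<beta> Y t"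
    using volterra_linear_exists[OF \<beta>, of "\<lambda>t. \<xi> t + J t" A] \<xi> J_cont continuous_on_add by blast
  have "solution_linear \<alpha> \<beta> A \<xi> f \<theta> Y"
    unfolding solution_linear_def
  proof (intro conjI allI impI)
    fix t :: real assume t: "0 \<le> t"
    show "set_integrable lborel {0..t} (\<lambda>s. (t - s) powr (\<beta> - 1) * (A * Y s))"
      using kernel_integrable_mult[OF kernel_integrable_continuous[OF \<beta> Y(1)], of A t]
      unfolding kernel_integrable_def .
    show "\<exists>I. has_young_integral (\<lambda>s. (t - s) powr (\<alpha> - 1) * f s) \<theta> 0 t I \<and>
        Y t = \<xi> t + 1 / Gamma \<beta> * (LINT s:{0..t}|lborel. (t - s) powr (\<beta> - 1) * (A * Y s)) + 1 / Gamma \<alpha> * I"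
    proof (intro exI conjI)
      show "has_young_integral (\<lambda>s. (t - s) powr (\<alpha> - 1) * f s) \<theta> 0 t (Gamma \<alpha> * J t)"
        unfolding J_def by (rule has_young_integral_frac_kernel[OF \<alpha> t f \<theta>])
      have "1 / Gamma \<alpha> * (Gamma \<alpha> * J t) = J t"
        using less_imp_neq[OF Gamma_real_pos[of \<alpha>]] \<alpha> by simp
      moreover have "1 / Gamma \<beta> * (LINT s:{0..t}|lborel. (t - s) powr (\<beta> - 1) * (A * Y s)) = A * frac_integral \<beta> Y t"
        using frac_integral_mult[of \<beta> A Y t] by (simp only: frac_integral_def)
      ultimately show "Y t = \<xi> t + 1 / Gamma \<beta> * (LINT s:{0..t}|lborel. (t - s) powr (\<beta> - 1) * (A * Y s))
          + 1 / Gamma \<alpha> * (Gamma \<alpha> * J t)"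
        using Y(2)[OF t] by simp
    qed
  qed (rule Y(1))
  then show ?thesis by (rule that)
qed

text \<open>The initial function and the Young integral cancel, and A X - A Y is linear in the
  difference.\<close>

lemma solution_difference:
  assumes \<beta>: "0 < \<beta>"
    and X: "solution_nonlinear \<alpha> \<beta> A h \<xi> f \<theta> X" and Y: "solution_linear \<alpha> \<beta> A \<xi> f \<theta> Y" and t: "0 \<le> t"
  shows "X t - Y t = frac_integral \<beta> (\<lambda>s. h (X s)) t - (- A) * frac_integral \<beta> (\<lambda>s. X s - Y s) t"
proof -
  have cont: "continuous_on {0..} X" "continuous_on {0..} Y"
    using X Y unfolding solution_nonlinear_def solution_linear_def by auto
  obtain I where I: "has_young_integral (\<lambda>s. (t - s) powr (\<alpha> - 1) * f s) \<theta> 0 t I"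
      "X t = \<xi> t + frac_integral \<beta> (\<lambda>s. A * X s + h (X s)) t + 1 / Gamma \<alpha> * I"
    and X_int: "kernel_integrable \<beta> (\<lambda>s. A * X s + h (X s)) t"
    using X[unfolded solution_nonlinear_def, THEN conjunct2, rule_format, OF t]
    unfolding frac_integral_def kernel_integrable_def by (elim conjE exE)
  obtain J where J: "has_young_integral (\<lambda>s. (t - s) powr (\<alpha> - 1) * f s) \<theta> 0 t J"
      "Y t = \<xi> t + frac_integral \<beta> (\<lambda>s. A * Y s) t + 1 / Gamma \<alpha> * J"
    using Y[unfolded solution_linear_def, THEN conjunct2, rule_format, OF t]
    unfolding frac_integral_def by (elim conjE exE)
  have "I = J" using t I(1) J(1) by (rule has_young_integral_unique)
  have XY: "kernel_integrable \<beta> X t" "kernel_integrable \<beta> Y t"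
    using cont \<beta> by (auto intro: kernel_integrable_continuous)
  then have "kernel_integrable \<beta> (\<lambda>s. h (X s)) t"
    \<comment> \<open>Integrability of the h-term comes from the solution notion itself, by removing
      the continuous part A X; no growth bound on h enters.\<close>
    using kernel_integrable_diff[OF X_int kernel_integrable_mult[OF XY(1), of A]] by simp
  then have "frac_integral \<beta> (\<lambda>s. A * X s + h (X s)) t = A * frac_integral \<beta> X t + frac_integral \<beta> (\<lambda>s. h (X s)) t"
    using frac_integral_add[OF kernel_integrable_mult[OF XY(1), of A]] by (simp add: frac_integral_mult)
  then show ?thesis
    using I(2) J(2) \<open>I = J\<close> by (simp add: frac_integral_diff[OF XY] frac_integral_mult algebra_simps)
qed

text \<open>X is controlled on the half-line only, so it is cut off before it is composed with h; on
  [0, t] this changes nothing.\<close>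

lemma set_borel_measurable_compose:
  fixes h X :: "real \<Rightarrow> real"
  assumes [measurable]: "h \<in> borel_measurable borel" and X: "continuous_on {0..} X"
  shows "set_borel_measurable lborel {0..t} (\<lambda>s. h (X s))"
proof -
  have [measurable]: "(\<lambda>s. indicator {0..t} s *\<^sub>R X s) \<in> borel_measurable lborel"
    using continuous_on_set_borel_measurable[OF X order_refl] unfolding set_borel_measurable_def .
  have "(\<lambda>s. indicator {0..t} s *\<^sub>R h (indicator {0..t} s *\<^sub>R X s)) \<in> borel_measurable lborel"
    by measurable
  moreover have "indicator {0..t} s *\<^sub>R h (indicator {0..t} s *\<^sub>R X s) = indicator {0..t} s *\<^sub>R h (X s)" for s
    by (auto simp: indicator_def)
  ultimately show ?thesis unfolding set_borel_measurable_def by (simp only:)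
qed

text \<open>Up to the first time with |X| = e the forcing is at most C e, so |X - Y| is at most (C /
  c) e there. The threshold (1 - C / c) e for Y is exactly the room that remains, and its strictness
  gives the contradiction.\<close>

lemma nonlinear_stays_small:
  fixes X Y h :: "real \<Rightarrow> real" and b c C e :: real
  assumes b: "0 < b" "b \<le> 1" and C: "0 < C" "C < c" and e: "0 < e"
    and h: "h \<in> borel_measurable borel" "\<And>x. \<bar>x\<bar> \<le> e \<Longrightarrow> \<bar>h x\<bar> \<le> C * \<bar>x\<bar>"
    and X: "continuous_on {0..} X" and Y: "continuous_on {0..} Y"
    and eq: "\<And>t. 0 \<le> t \<Longrightarrow>
      X t - Y t = frac_integral b (\<lambda>s. h (X s)) t - c * frac_integral b (\<lambda>s. X s - Y s) t"
    and small: "\<And>t. 0 \<le> t \<Longrightarrow> \<bar>Y t\<bar> < (1 - C / c) * e" and t: "0 \<le> t"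
  shows "\<bar>X t\<bar> < e"
proof (rule ccontr)
  assume big: "\<not> \<bar>X t\<bar> < e"
  have c: "0 < c" using C by simp
  obtain S where S: "continuous_on {0..} S" "\<And>t. 0 \<le> t \<Longrightarrow> S t = 1 - c * frac_integral b S t"
      "\<And>t. 0 \<le> t \<Longrightarrow> 0 < S t"
    using volterra_relaxation[OF b, of c] c by (metis less_imp_le)
  have "X 0 = Y 0" using eq[of 0] by simp
  moreover have "(1 - C / c) * e \<le> e" using C e by (simp add: field_simps)
  ultimately have "0 < e - \<bar>X 0\<bar>" using small[of 0] by simp
  moreover have "continuous_on {0..} (\<lambda>t. e - \<bar>X t\<bar>)" by (intro continuous_intros X)
  ultimately obtain r where r: "0 < r" "\<bar>X r\<bar> = e" and below: "\<And>s. 0 \<le> s \<Longrightarrow> s < r \<Longrightarrow> \<bar>X s\<bar> < e"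
    using first_zero[of "\<lambda>t. e - \<bar>X t\<bar>" t] big t by auto
  have h_le: "\<bar>h (X s)\<bar> \<le> C * e" if "0 \<le> s" "s \<le> r" for s
  proof -
    have "\<bar>X s\<bar> \<le> e" using below[of s] r that by (cases "s = r") auto
    then show ?thesis using h(2)[of "X s"] C by (meson mult_left_mono less_imp_le order_trans)
  qed
  have XY: "continuous_on {0..} (\<lambda>s. X s - Y s)" by (intro continuous_intros X Y)
  \<comment> \<open>With T = 0 the past term vanishes, and S r > 0 bounds the rest by C e.\<close>
  have "c * \<bar>X r - Y r\<bar> \<le> C * e * (S (r - 0) - S r) + C * e * (1 - S (r - 0))"
    by (rule volterra_bound[OF b c S(1,2), where k = "\<lambda>s. h (X s)" and Z = "\<lambda>s. X s - Y s"])
      (use r h_le eq XY set_borel_measurable_compose[OF h(1) X] in auto)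
  also have "\<dots> \<le> C * e" using S(3)[of r] r C e by (simp add: algebra_simps)
  finally have "\<bar>X r - Y r\<bar> \<le> C / c * e" using c by (simp add: field_simps)
  moreover have "\<bar>Y r\<bar> < e - C / c * e" using small[of r] r by (simp add: left_diff_distrib)
  ultimately show False using r(2) by linarith
qed

text \<open>An eventual bound m improves to q' m with q' < 1: the bound M on the past is multiplied
  by increments of the convergent function S, Y tends to 0, and the recent forcing contributes at
  most (C / c) m. Iteration gives a geometric sequence of eventual bounds.\<close>

lemma nonlinear_tendsto_0:
  fixes X Y h :: "real \<Rightarrow> real" and b c C M :: real
  assumes b: "0 < b" "b \<le> 1" and C: "0 < C" "C < c"
    and h: "h \<in> borel_measurable borel" "\<And>t. 0 \<le> t \<Longrightarrow> \<bar>h (X t)\<bar> \<le> C * \<bar>X t\<bar>"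
    and X: "continuous_on {0..} X" and Y: "continuous_on {0..} Y"
    and eq: "\<And>t. 0 \<le> t \<Longrightarrow>
      X t - Y t = frac_integral b (\<lambda>s. h (X s)) t - c * frac_integral b (\<lambda>s. X s - Y s) t"
    and bdd: "\<And>t. 0 \<le> t \<Longrightarrow> \<bar>X t\<bar> \<le> M" and lim: "(Y \<longlongrightarrow> 0) at_top"
  shows "(X \<longlongrightarrow> 0) at_top"
proof -
  have c: "0 < c" using C by simp
  obtain S where S: "continuous_on {0..} S" "\<And>t. 0 \<le> t \<Longrightarrow> S t = 1 - c * frac_integral b S t"
      "\<And>t. 0 \<le> t \<Longrightarrow> 0 < S t" "\<And>t t'. 0 \<le> t \<Longrightarrow> t \<le> t' \<Longrightarrow> S t' \<le> S t"
    using volterra_relaxation[OF b, of c] c by (metis less_imp_le)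
  define L where "L = Inf (S ` {0..})"
  have L_le: "L \<le> S t" if "0 \<le> t" for t
    unfolding L_def using S(3) that by (intro cInf_lower bdd_belowI[of _ 0]) (auto simp: less_imp_le)
  have S_lim: "(S \<longlongrightarrow> L) at_top"
  proof (rule order_tendstoI)
    fix a assume a: "a < L"
    show "\<forall>\<^sub>F t in at_top. a < S t"
      using eventually_ge_at_top[of 0] by eventually_elim (rule less_le_trans[OF a L_le])
  next
    fix a assume "L < a"
    then obtain t0 where t0: "0 \<le> t0" "S t0 < a"
      unfolding L_def using cInf_lessD[of "S ` {0..}" a] by auto
    show "\<forall>\<^sub>F t in at_top. S t < a"
      using eventually_ge_at_top[of t0] by eventually_elim (use t0 S(4) in \<open>meson le_less_trans\<close>)
  qed
  define q where "q = C / c"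
  \<comment> \<open>The midpoint between q and 1 leaves room for the terms that tend to 0 but are
    not 0.\<close>
  define q' where "q' = (1 + q) / 2"
  have q: "0 < q" "q < q'" "q' < 1" using C by (auto simp: q_def q'_def field_simps)
  have step: "\<forall>\<^sub>F t in at_top. \<bar>X t\<bar> \<le> q' * m" if m: "0 < m" and ev: "\<forall>\<^sub>F t in at_top. \<bar>X t\<bar> \<le> m" for m
  proof -
    obtain T0 where T0: "\<And>t. T0 \<le> t \<Longrightarrow> \<bar>X t\<bar> \<le> m"
      using ev by (auto simp: eventually_at_top_linorder)
    define T where "T = max 0 T0"
    have T: "0 \<le> T" "\<And>t. T \<le> t \<Longrightarrow> \<bar>X t\<bar> \<le> m" using T0 by (auto simp: T_def)
    have est: "\<bar>X t\<bar> \<le> \<bar>Y t\<bar> + q * M * (S (t - T) - S t) + q * m" if t: "T \<le> t" for t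
    proof -
      have hM: "\<bar>h (X s)\<bar> \<le> C * B" if "0 \<le> s" "\<bar>X s\<bar> \<le> B" for s B
        using h(2)[OF that(1)] that(2) C by (meson mult_left_mono less_imp_le order_trans)
      have XY: "continuous_on {0..} (\<lambda>s. X s - Y s)" by (intro continuous_intros X Y)
      have "c * \<bar>X t - Y t\<bar> \<le> C * M * (S (t - T) - S t) + C * m * (1 - S (t - T))"
        by (rule volterra_bound[OF b c S(1,2), where k = "\<lambda>s. h (X s)" and Z = "\<lambda>s. X s - Y s"])
          (use T t eq bdd hM XY set_borel_measurable_compose[OF h(1) X] in \<open>auto simp: mult.assoc\<close>)
      also have "\<dots> \<le> C * M * (S (t - T) - S t) + C * m"
        using S(3)[of "t - T"] C m t by (simp add: algebra_simps)
      finally have "\<bar>X t - Y t\<bar> \<le> q * M * (S (t - T) - S t) + q * m"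
        using c unfolding q_def by (simp add: field_simps)
      then show ?thesis by linarith
    qed
    have "filterlim (\<lambda>t. t - T) at_top at_top"
      using filterlim_tendsto_add_at_top[OF tendsto_const[of "- T"] filterlim_ident] by simp
    then have "((\<lambda>t. S (t - T)) \<longlongrightarrow> L) at_top"
      by (rule filterlim_compose[OF S_lim])
    then have "((\<lambda>t. \<bar>Y t\<bar> + q * M * (S (t - T) - S t) + q * m) \<longlongrightarrow> \<bar>0\<bar> + q * M * (L - L) + q * m) at_top"
      by (intro tendsto_intros lim S_lim)
    then have "\<forall>\<^sub>F t in at_top. \<bar>Y t\<bar> + q * M * (S (t - T) - S t) + q * m < q' * m"
      using q m by (intro order_tendstoD(2)) auto
    then show ?thesis
      using eventually_ge_at_top[of T] by eventually_elim (use est in force)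
  qed
  have M0: "0 \<le> M" using bdd[of 0] by simp
  \<comment> \<open>The contraction step needs a positive bound; M may be 0, hence M + 1.\<close>
  have geometric: "\<forall>\<^sub>F t in at_top. \<bar>X t\<bar> \<le> (M + 1) * q' ^ n" for n
  proof (induction n)
    case 0
    show ?case using eventually_ge_at_top[of 0] by eventually_elim (use bdd in force)
  next
    case (Suc n)
    have "0 < (M + 1) * q' ^ n" using M0 q by simp
    then show ?case using step[OF _ Suc] by (simp add: mult_ac)
  qed
  show ?thesis
  proof (rule tendstoI)
    fix e :: real assume "0 < e"
    have "(\<lambda>n. (M + 1) * q' ^ n) \<longlonglongrightarrow> (M + 1) * 0"
      using q by (intro tendsto_intros LIMSEQ_realpow_zero) auto
    then have "\<forall>\<^sub>F n in sequentially. (M + 1) * q' ^ n < e"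
      using \<open>0 < e\<close> by (intro order_tendstoD(2)) auto
    then obtain n where "(M + 1) * q' ^ n < e" by (auto simp: eventually_sequentially)
    with geometric[of n] show "\<forall>\<^sub>F t in at_top. dist (X t) 0 < e"
      by (auto elim!: eventually_mono)
  qed
qed

section \<open>Transfer of stability from the linear to the nonlinear equation\<close>

lemma small_data_mono:
  assumes "small_data p \<xi> f \<theta> \<delta>" "\<delta> \<le> \<delta>'"
  shows "small_data p \<xi> f \<theta> \<delta>'"
  using assms(1) ennreal_leI[OF assms(2)] unfolding small_data_def by (rule order.strict_trans2)

lemma SUP_abs_less_imp:
  assumes "(SUP t\<in>{0..}. ennreal \<bar>X t\<bar>) < ennreal e" "0 \<le> (t::real)"
  shows "\<bar>X t\<bar> < e"
proof -
  have "ennreal \<bar>X t\<bar> \<le> (SUP t\<in>{0..}. ennreal \<bar>X t\<bar>)"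
    using assms(2) by (intro SUP_upper) auto
  then show ?thesis using assms(1) by (metis abs_ge_zero ennreal_less_iff order.strict_trans1)
qed

text \<open>For a radius e below \<open>\<delta>\<^sub>0\<close>, the \<delta> that keeps every
  solution of (2) below (1 - C / c) e keeps those of (1) below e. They then remain where h is
  linearly bounded, which is what the decay argument requires.\<close>

theorem asymptotically_stable_nonlinear:
  assumes \<beta>: "0 < \<beta>" "\<beta> < 1" and \<alpha>: "1 < \<alpha>" and \<gamma>: "0 < \<gamma>"
    and h: "h \<in> borel_measurable borel" "\<And>x. \<bar>x\<bar> < \<delta>\<^sub>0 \<Longrightarrow> \<bar>h x\<bar> \<le> C * \<bar>x\<bar>"
    and \<delta>\<^sub>0: "0 < \<delta>\<^sub>0" and C: "0 < C" "A + C < 0"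
    and ev: "\<And>\<xi>. \<xi> \<in> E \<Longrightarrow> continuous_on {0..} (ev \<xi>)"
    and lin: "asymptotically_stable \<gamma> \<tau> ev E p (solution_linear \<alpha> \<beta> A)"
  shows "asymptotically_stable \<gamma> \<tau> ev E p (solution_nonlinear \<alpha> \<beta> A h)"
proof -
  define c where "c = - A"
  have Cc: "C < c" and k: "0 < 1 - C / c" and \<beta>1: "\<beta> \<le> 1" using C \<beta> by (auto simp: c_def field_simps)
  have bound: "\<exists>\<delta>>0. \<forall>\<xi>\<in>E. \<forall>f \<theta>. admissible \<gamma> \<tau> f \<theta> \<and> small_data p \<xi> f \<theta> \<delta> \<longrightarrow>
      (\<forall>X. solution_nonlinear \<alpha> \<beta> A h (ev \<xi>) f \<theta> X \<longrightarrow> (\<forall>t\<ge>0. \<bar>X t\<bar> < e))"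
    if e: "0 < e" "e < \<delta>\<^sub>0" for e
  proof -
    have pos: "0 < (1 - C / c) * e" using k e(1) by (rule mult_pos_pos)
    from lin[unfolded asymptotically_stable_def stable_def, THEN conjunct1, rule_format, OF pos]
    obtain \<delta> where \<delta>: "0 < \<delta>" and small: "\<And>\<xi> f \<theta> Y. \<xi> \<in> E \<Longrightarrow> admissible \<gamma> \<tau> f \<theta> \<Longrightarrow> small_data p \<xi> f \<theta> \<delta> \<Longrightarrow>
        solution_linear \<alpha> \<beta> A (ev \<xi>) f \<theta> Y \<Longrightarrow> (SUP t\<in>{0..}. ennreal \<bar>Y t\<bar>) < ennreal ((1 - C / c) * e)"
      by (elim exE conjE) blast
    show ?thesis
    proof (intro exI[of _ \<delta>] conjI \<delta> ballI allI impI, elim conjE)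
      fix \<xi> f \<theta> X t
      assume \<xi>: "\<xi> \<in> E" and adm: "admissible \<gamma> \<tau> f \<theta>" and sd: "small_data p \<xi> f \<theta> \<delta>"
        and X: "solution_nonlinear \<alpha> \<beta> A h (ev \<xi>) f \<theta> X" and t: "0 \<le> (t::real)"
      obtain Y where Y: "solution_linear \<alpha> \<beta> A (ev \<xi>) f \<theta> Y"
        using solution_linear_exists[OF \<beta>(1) \<alpha> \<gamma> ev[OF \<xi>] adm] by blast
      show "\<bar>X t\<bar> < e"
      proof (rule nonlinear_stays_small[OF \<beta>(1) \<beta>1 C(1) Cc e(1) h(1) _ _ _ _ _ t, where X = X and Y = Y])
        show "continuous_on {0..} X" "continuous_on {0..} Y"
          using X Y unfolding solution_nonlinear_def solution_linear_def by auto
        show "\<bar>Y s\<bar> < (1 - C / c) * e" if "0 \<le> s" for s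
          using SUP_abs_less_imp[OF small[OF \<xi> adm sd Y] that] .
        show "\<bar>h x\<bar> \<le> C * \<bar>x\<bar>" if "\<bar>x\<bar> \<le> e" for x
          using that e(2) by (intro h(2)) simp
      qed (use solution_difference[OF \<beta>(1) X Y] in \<open>unfold c_def\<close>)
    qed
  qed
  show ?thesis
    unfolding asymptotically_stable_def
  proof
    show "stable \<gamma> \<tau> ev E p (solution_nonlinear \<alpha> \<beta> A h)"
      unfolding stable_def
    proof (intro allI impI)
      fix e :: real assume e: "0 < e"
      \<comment> \<open>Strictly below \<open>\<delta>\<^sub>0\<close>, so that the bound on h holds
        on the closed ball of radius e'; strictly below e, since the supremum may equal e'.\<close>
      define e' where "e' = min e \<delta>\<^sub>0 / 2"
      have e': "0 < e'" "e' < \<delta>\<^sub>0" "e' < e" using e \<delta>\<^sub>0 by (auto simp: e'_def)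
      obtain \<delta> where \<delta>: "0 < \<delta>" and *: "\<And>\<xi> f \<theta> X t. \<xi> \<in> E \<Longrightarrow> admissible \<gamma> \<tau> f \<theta> \<Longrightarrow> small_data p \<xi> f \<theta> \<delta> \<Longrightarrow>
          solution_nonlinear \<alpha> \<beta> A h (ev \<xi>) f \<theta> X \<Longrightarrow> 0 \<le> t \<Longrightarrow> \<bar>X t\<bar> < e'"
        using bound[OF e'(1,2)] by blast
      have "(SUP t\<in>{0..}. ennreal \<bar>X t\<bar>) < ennreal e"
        if "\<xi> \<in> E" "admissible \<gamma> \<tau> f \<theta>" "small_data p \<xi> f \<theta> \<delta>" "solution_nonlinear \<alpha> \<beta> A h (ev \<xi>) f \<theta> X"
        for \<xi> f \<theta> X
      proof -
        have "(SUP t\<in>{0..}. ennreal \<bar>X t\<bar>) \<le> ennreal e'"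
          by (intro SUP_least ennreal_leI less_imp_le[OF *[OF that]]) auto
        also have "\<dots> < ennreal e" using e' by (simp add: ennreal_less_iff)
        finally show ?thesis .
      qed
      with \<delta> show "\<exists>\<delta>>0. \<forall>\<xi>\<in>E. \<forall>f \<theta>. admissible \<gamma> \<tau> f \<theta> \<and> small_data p \<xi> f \<theta> \<delta> \<longrightarrow>
          (\<forall>X. solution_nonlinear \<alpha> \<beta> A h (ev \<xi>) f \<theta> X \<longrightarrow> (SUP t\<in>{0..}. ennreal \<bar>X t\<bar>) < ennreal e)"
        by blast
    qed
    define e where "e = \<delta>\<^sub>0 / 2"
    have e: "0 < e" "e < \<delta>\<^sub>0" using \<delta>\<^sub>0 by (auto simp: e_def)
    obtain \<delta>1 where \<delta>1: "0 < \<delta>1" and bdd: "\<And>\<xi> f \<theta> X t. \<xi> \<in> E \<Longrightarrow> admissible \<gamma> \<tau> f \<theta> \<Longrightarrow> small_data p \<xi> f \<theta> \<delta>1 \<Longrightarrow>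
        solution_nonlinear \<alpha> \<beta> A h (ev \<xi>) f \<theta> X \<Longrightarrow> 0 \<le> t \<Longrightarrow> \<bar>X t\<bar> < e"
      using bound[OF e] by blast
    obtain \<delta>2 where \<delta>2: "0 < \<delta>2" and lim: "\<And>\<xi> f \<theta> Y. \<xi> \<in> E \<Longrightarrow> admissible \<gamma> \<tau> f \<theta> \<Longrightarrow> small_data p \<xi> f \<theta> \<delta>2 \<Longrightarrow>
        solution_linear \<alpha> \<beta> A (ev \<xi>) f \<theta> Y \<Longrightarrow> (Y \<longlongrightarrow> 0) at_top"
      using lin unfolding asymptotically_stable_def by blast
    show "\<exists>\<delta>>0. \<forall>\<xi>\<in>E. \<forall>f \<theta>. admissible \<gamma> \<tau> f \<theta> \<and> small_data p \<xi> f \<theta> \<delta> \<longrightarrow>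
        (\<forall>X. solution_nonlinear \<alpha> \<beta> A h (ev \<xi>) f \<theta> X \<longrightarrow> (X \<longlongrightarrow> 0) at_top)"
    \<comment> \<open>\<open>\<delta>1\<close> confines X to the region where h is controlled,
      \<open>\<delta>2\<close> makes Y tend to 0.\<close>
    proof (intro exI[of _ "min \<delta>1 \<delta>2"] conjI ballI allI impI, goal_cases)
      case 1
      then show ?case using \<delta>1 \<delta>2 by simp
    next
      case (2 \<xi> f \<theta> X)
      then have \<xi>: "\<xi> \<in> E" and adm: "admissible \<gamma> \<tau> f \<theta>"
        and X: "solution_nonlinear \<alpha> \<beta> A h (ev \<xi>) f \<theta> X"
        and sd: "small_data p \<xi> f \<theta> \<delta>1" "small_data p \<xi> f \<theta> \<delta>2"
        using small_data_mono[of p \<xi> f \<theta> "min \<delta>1 \<delta>2"] by auto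
      obtain Y where Y: "solution_linear \<alpha> \<beta> A (ev \<xi>) f \<theta> Y"
        using solution_linear_exists[OF \<beta>(1) \<alpha> \<gamma> ev[OF \<xi>] adm] by blast
      have small: "\<bar>X t\<bar> < e" if "0 \<le> t" for t using bdd[OF \<xi> adm sd(1) X that] .
      show ?case
      proof (rule nonlinear_tendsto_0[OF \<beta>(1) \<beta>1 C(1) Cc h(1)])
        show "continuous_on {0..} X" "continuous_on {0..} Y"
          using X Y unfolding solution_nonlinear_def solution_linear_def by auto
        show "\<bar>h (X t)\<bar> \<le> C * \<bar>X t\<bar>" if "0 \<le> t" for t
          using small[OF that] e by (intro h(2)) simp
        show "\<bar>X t\<bar> \<le> e" if "0 \<le> t" for t using small[OF that] by simp
        show "(Y \<longlongrightarrow> 0) at_top" by (rule lim[OF \<xi> adm sd(2) Y])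
      qed (use solution_difference[OF \<beta>(1) X Y] in \<open>unfold c_def\<close>)
    qed
  qed
qed

lemma continuous_tendsto_bounded:
  fixes Y :: "real \<Rightarrow> real"
  assumes Y: "continuous_on {0..} Y" and lim: "(Y \<longlongrightarrow> 0) at_top"
  obtains B where "\<And>t. 0 \<le> t \<Longrightarrow> \<bar>Y t\<bar> < B"
proof -
  have "\<forall>\<^sub>F t in at_top. dist (Y t) 0 < 1" using lim by (rule tendstoD) simp
  then obtain T where T: "\<And>t. T \<le> t \<Longrightarrow> \<bar>Y t\<bar> < 1"
    by (auto simp: eventually_at_top_linorder)
  obtain M where M: "0 \<le> M" "\<And>s. 0 \<le> s \<Longrightarrow> s \<le> T \<Longrightarrow> \<bar>Y s\<bar> \<le> M"
    using continuous_on_halfline_bounded[OF Y] by blast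
  show ?thesis
  proof (rule that)
    show "\<bar>Y t\<bar> < M + 1" if "0 \<le> t" for t
      using T[of t] M(1) M(2)[OF that] by (cases "T \<le> t") auto
  qed
qed

text \<open>Without smallness of the data, boundedness of X comes from that of Y: a continuous Y
  tending to 0 is bounded, and as the bound on h is global, the confinement argument works at any
  radius.\<close>

theorem globally_stable_nonlinear:
  assumes \<beta>: "0 < \<beta>" "\<beta> < 1" and \<alpha>: "1 < \<alpha>" and \<gamma>: "0 < \<gamma>"
    and h: "h \<in> borel_measurable borel" "\<And>x. \<bar>h x\<bar> \<le> C * \<bar>x\<bar>"
    and C: "0 < C" "A + C < 0"
    and ev: "\<And>\<xi>. \<xi> \<in> E \<Longrightarrow> continuous_on {0..} (ev \<xi>)" and adm: "admissible \<gamma> \<tau> f \<theta>"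
    and lin: "globally_stable_in_the_large ev E f \<theta> (solution_linear \<alpha> \<beta> A)"
  shows "globally_stable_in_the_large ev E f \<theta> (solution_nonlinear \<alpha> \<beta> A h)"
  unfolding globally_stable_in_the_large_def
proof (intro ballI allI impI)
  fix \<xi> X assume \<xi>: "\<xi> \<in> E" and X: "solution_nonlinear \<alpha> \<beta> A h (ev \<xi>) f \<theta> X"
  define c where "c = - A"
  have Cc: "C < c" and k: "0 < 1 - C / c" and \<beta>1: "\<beta> \<le> 1" using C \<beta> by (auto simp: c_def field_simps)
  obtain Y where Y: "solution_linear \<alpha> \<beta> A (ev \<xi>) f \<theta> Y"
    using solution_linear_exists[OF \<beta>(1) \<alpha> \<gamma> ev[OF \<xi>] adm] by blast
  have cont: "continuous_on {0..} X" "continuous_on {0..} Y"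
    using X Y unfolding solution_nonlinear_def solution_linear_def by auto
  have lim: "(Y \<longlongrightarrow> 0) at_top"
    using lin \<xi> Y unfolding globally_stable_in_the_large_def by blast
  obtain B where B: "\<And>t. 0 \<le> t \<Longrightarrow> \<bar>Y t\<bar> < B"
    using continuous_tendsto_bounded[OF cont(2) lim] by blast
  have B0: "0 < B" using B[of 0] by simp
  \<comment> \<open>The radius is chosen so that the threshold for Y, (1 - C / c) times the radius,
    is exactly B.\<close>
  have bdd: "\<bar>X t\<bar> < B / (1 - C / c)" if "0 \<le> t" for t
  proof (rule nonlinear_stays_small[OF \<beta>(1) \<beta>1 C(1) Cc _ h(1,2) cont _ _ that])
    show "0 < B / (1 - C / c)" using k B0 by (rule divide_pos_pos[rotated])
    show "\<bar>Y s\<bar> < (1 - C / c) * (B / (1 - C / c))" if "0 \<le> s" for s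
      using B[OF that] nonzero_mult_div_cancel_left[OF less_imp_neq[OF k, symmetric], of B]
      by (simp only: times_divide_eq_right)
  qed (use solution_difference[OF \<beta>(1) X Y] in \<open>unfold c_def\<close>)
  show "(X \<longlongrightarrow> 0) at_top"
    by (rule nonlinear_tendsto_0[OF \<beta>(1) \<beta>1 C(1) Cc h(1,2) cont _ less_imp_le[OF bdd] lim])
      (use solution_difference[OF \<beta>(1) X Y] in \<open>unfold c_def\<close>)
qed

theorem theorem4p2:
  fixes \<alpha> \<beta> \<gamma> \<tau> A p :: real
    and h :: "real \<Rightarrow> real"
    and E :: "'x::real_normed_vector set"
    and ev :: "'x \<Rightarrow> real \<Rightarrow> real"
  assumes "0 < \<beta>" "\<beta> < 1"
    and "A < 0"
    and "1 < \<alpha>" "\<alpha> < 2"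
    and "0 < \<gamma>" "\<gamma> < 1"
    and "\<alpha> + \<gamma> > 2"
    and "\<tau> + \<gamma> > 1"
    and "p \<ge> 1"
    and "h \<in> borel_measurable borel"
    and "\<And>\<xi>. \<xi> \<in> E \<Longrightarrow> continuous_on {0..} (ev \<xi>)"
    and "inj_on (\<lambda>\<xi>. restrict (ev \<xi>) {0..}) E"
  shows
    "((\<exists>\<delta>\<^sub>0>0. \<exists>C>0. A + C < 0 \<and> (\<forall>x. \<bar>x\<bar> < \<delta>\<^sub>0 \<longrightarrow> \<bar>h x\<bar> \<le> C * \<bar>x\<bar>)) \<longrightarrow>
       asymptotically_stable \<gamma> \<tau> ev E p (solution_linear \<alpha> \<beta> A) \<longrightarrow>
       asymptotically_stable \<gamma> \<tau> ev E p (solution_nonlinear \<alpha> \<beta> A h))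
     \<and>
     ((\<exists>C>0. A + C < 0 \<and> (\<forall>x. \<bar>h x\<bar> \<le> C * \<bar>x\<bar>)) \<longrightarrow>
       (\<forall>f \<theta>. admissible \<gamma> \<tau> f \<theta> \<longrightarrow>
          globally_stable_in_the_large ev E f \<theta> (solution_linear \<alpha> \<beta> A) \<longrightarrow>
          globally_stable_in_the_large ev E f \<theta> (solution_nonlinear \<alpha> \<beta> A h)))"
proof (intro conjI impI allI, goal_cases)
  case 1
  then obtain \<delta>\<^sub>0 C where "0 < \<delta>\<^sub>0" "0 < C" "A + C < 0" "\<And>x. \<bar>x\<bar> < \<delta>\<^sub>0 \<Longrightarrow> \<bar>h x\<bar> \<le> C * \<bar>x\<bar>"
    by blast
  with 1 assms show ?case
    by (intro asymptotically_stable_nonlinear[where \<delta>\<^sub>0 = \<delta>\<^sub>0 and C = C])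
next
  case (2 f \<theta>)
  then obtain C where "0 < C" "A + C < 0" "\<And>x. \<bar>h x\<bar> \<le> C * \<bar>x\<bar>"
    by blast
  with 2 assms show ?case
    by (intro globally_stable_nonlinear[where C = C])
qed

end
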